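(* Let $X$ and $Y$ be closure spaces. Define a partial order on pairs $(J,\otimes)$, where $\otimes$ is a product operation and $J$ is an interval for $\otimes$, by setting $(J,\otimes)\le(J',\otimes')$ if for all continuous $f,g:X\to Y$, $f\sim_{(J,\otimes)}g$ implies $f\sim_{(J',\otimes')}g$ (that is, if $(J',\otimes')$ gives a coarser partition of the set of continuous maps from $X$ to $Y$). With this partial order on intervals and product operations we have the following poset, which is independent of $X$ and $Y$: its elements are the eight pairs $( *,\times)$, $(J_\top,\times)$, $(J_+,\times)$, $(J_\top,\boxplus)$, $(I_\tau,\times)$, $(J_+,\boxplus)$, $(I_\tau,\boxplus)$, $(J_\bot,\times)$, and its Hasse diagram has the following edges (lower element listed first): $$( *,\times)-(J_\top,\times),\quad (J_\top,\times)-(J_+,\times),\quad (J_\top,\times)-(J_\top,\boxplus),\quad (J_+,\times)-(I_\tau,\times),\quad (J_+,\times)-(J_+,\boxplus),$$ $$(J_\top,\boxplus)-(J_+,\boxplus),\quad (I_\tau,\times)-(I_\tau,\boxplus),\quad (J_+,\boxplus)-(I_\tau,\boxplus),\quad (I_\tau,\boxplus)-(J_\bot,\times).$$ Here $f\sim_{( *,\times)}g$ if and only if $f=g$, and thus $( *,\times)$ is the minimum; and $f\sim_{(J_\bot,\times)}g$ for all continuous $f,g:X\to Y$, and thus $(J_\bot,\times)$ is the maximum.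
   Context: A (Čech) closure space $(X,c)$ is a set $X$ with a function $c:2^X\to 2^X$ such that $c(\varnothing)=\varnothing$, $A\subset c(A)$, and $c(A\cup B)=c(A)\cup c(B)$ for all $A,B\subset X$. Write $c(x)$ for $c(\{x\})$. A map $f:(X,c_X)\to(Y,c_Y)$ is continuous if $f(c_X(A))\subset c_Y(f(A))$ for all $A\subset X$. $\mathbf{Cl}$ is the category of closure spaces and continuous maps; its terminal object is the one-point space $*$. A set $U\subset X$ is a neighborhood of $x$ if $x\notin c(X\setminus U)$. Products on $X\times Y$: the product closure is $(c_X\times c_Y)(A)=\{(x,y)\mid (U\times V)\cap A\neq\varnothing$ for all neighborhoods $U$ of $x$, $V$ of $y\}$; the inductive product closure is $(c_X\boxplus c_Y)(A)=\{(x,y)\mid ((\{x\}\times V)\cup(U\times\{y\}))\cap A\neq\varnothing$ for all neighborhoods $U$ of $x$, $V$ of $y\}$. A product operation is a functor $\otimes:\mathbf{Cl}\times\mathbf{Cl}\to\mathbf{Cl}$ for which $\mathbf{Cl}$ has a symmetric monoidal structure commuting with the forgetful functor to $\mathbf{Set}$ and the cartesian symmetric monoidal structure on $\mathbf{Set}$; i.e. $(X,c_X)\otimes(Y,c_Y)=(X\times Y,c_X\otimes c_Y)$ for some closure $c_X\otimes c_Y$, the unit is $*$, and the associator, unitors and braiding are those of $\mathbf{Set}$. Both $\times$ and $\boxplus$ are product operations. An interval for $\otimes$ is a closure space $J$ with two points $0_J,1_J:*\to J$ and a symmetric, associative continuous map $\vee:J\otimes J\to J$ with $0\vee t=t$ and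 $1\vee t=1$ for all $t$. Specific intervals (for every product operation): $I_\tau=[0,1]$ with the closure of its standard topology; $J_\top=\{0,1\}$ with the indiscrete closure ($c(A)=\{0,1\}$ for $A\ne\varnothing$); $J_+=\{0,1\}$ with $c(0)=\{0,1\}$, $c(1)=\{1\}$; $J_\bot=\{0,1\}$ with the discrete closure ($c(A)=A$); all with distinguished points $0,1$ and $\vee=\max$; and the one-point space $*$ with its unique structure (so $0_*=1_*$). For an interval $J$ for $\otimes$ and continuous $f,g:X\to Y$, an elementary $(J,\otimes)$ homotopy from $f$ to $g$ is a continuous map $H:X\otimes J\to Y$ with $H(x,0_J)=f(x)$ and $H(x,1_J)=g(x)$ for all $x$. The relation $\sim_{(J,\otimes)}$ is the equivalence relation on the set of continuous maps $X\to Y$ generated by elementary $(J,\otimes)$ homotopies.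
   Formalization: For fixed X, Y the order can degenerate (for X = Y = * all eight pairs are equivalent), so the listed relations, minimum and maximum are proved for every X, Y, while the partial order and the exact Hasse diagram are for the order requiring the implication for all X and Y. *)

theory Defs
  imports "HOL-Analysis.Analysis"
begin

section \<open>Closure spaces\<close>

text \<open>Only the values of \<open>clo X\<close> on subsets of \<open>pts X\<close> are meaningful.\<close>

record 'p cspace =
  pts :: "'p set"
  clo :: "'p set \<Rightarrow> 'p set"

definition closure_space :: "'p cspace \<Rightarrow> bool" where
  "closure_space X \<longleftrightarrow>
     clo X {} = {} \<and>
     (\<forall>A. A \<subseteq> pts X \<longrightarrow> A \<subseteq> clo X A \<and> clo X A \<subseteq> pts X) \<and>
     (\<forall>A B. A \<subseteq> pts X \<longrightarrow> B \<subseteq> pts X \<longrightarrow> clo X (A \<union> B) = clo X A \<union> clo X B)"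

definition cl_continuous :: "'p cspace \<Rightarrow> 'q cspace \<Rightarrow> ('p \<Rightarrow> 'q) \<Rightarrow> bool" where
  "cl_continuous X Y f \<longleftrightarrow>
     f \<in> pts X \<rightarrow> pts Y \<and> (\<forall>A. A \<subseteq> pts X \<longrightarrow> f ` clo X A \<subseteq> clo Y (f ` A))"

text \<open>Maps are taken extensional (\<open>undefined\<close> off \<open>pts X\<close>), so that equality of HOL functions
  is equality of maps on \<open>X\<close>.\<close>

definition cl_maps :: "'p cspace \<Rightarrow> 'q cspace \<Rightarrow> ('p \<Rightarrow> 'q) set" where
  "cl_maps X Y = {f \<in> extensional (pts X). cl_continuous X Y f}"

definition cl_homeo :: "'p cspace \<Rightarrow> 'q cspace \<Rightarrow> ('p \<Rightarrow> 'q) \<Rightarrow> bool" where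
  "cl_homeo X Y f \<longleftrightarrow>
     cl_continuous X Y f \<and>
     (\<exists>g. cl_continuous Y X g \<and> (\<forall>x\<in>pts X. g (f x) = x) \<and> (\<forall>y\<in>pts Y. f (g y) = y))"

definition nbhd :: "'p cspace \<Rightarrow> 'p \<Rightarrow> 'p set \<Rightarrow> bool" where
  "nbhd X x U \<longleftrightarrow> U \<subseteq> pts X \<and> x \<in> pts X \<and> x \<notin> clo X (pts X - U)"


section \<open>A universe of points closed under pairing\<close>

text \<open>A product operation acts on spaces of arbitrary underlying set, in particular on its own
  values, so it is not a HOL function on spaces over one fixed simple type unless that type is
  closed under pairing. The type \<open>'a pt\<close> contains every element of the arbitrary type \<open>'a\<close>
  (hence a copy of every closure space over \<open>'a\<close>), the real numbers (for the intervals), and is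
  freely closed under pairs. \<open>\<^bold>C\<^bold>l\<close> is represented by the closure spaces with points in
  \<open>'a pt\<close>, for arbitrary \<open>'a\<close>.\<close>

datatype 'a pt =
    Atom 'a
  | Num (num_val: real)
  | Pr (pr1: "'a pt") (pr2: "'a pt")

type_synonym 'a space = "'a pt cspace"
type_synonym 'a prod_op = "'a space \<Rightarrow> 'a space \<Rightarrow> 'a space"

definition pr_set :: "'a pt set \<Rightarrow> 'a pt set \<Rightarrow> 'a pt set" where
  "pr_set A B = {Pr a b | a b. a \<in> A \<and> b \<in> B}"

definition pr_map :: "('a pt \<Rightarrow> 'a pt) \<Rightarrow> ('a pt \<Rightarrow> 'a pt) \<Rightarrow> 'a pt \<Rightarrow> 'a pt" where
  "pr_map f g p = Pr (f (pr1 p)) (g (pr2 p))"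

definition pr_assoc :: "'a pt \<Rightarrow> 'a pt" where
  "pr_assoc p = Pr (pr1 (pr1 p)) (Pr (pr2 (pr1 p)) (pr2 p))"

definition pr_swap :: "'a pt \<Rightarrow> 'a pt" where
  "pr_swap p = Pr (pr2 p) (pr1 p)"

definition one_point :: "'a space" where
  "one_point = \<lparr>pts = {Num 0}, clo = (\<lambda>A. A)\<rparr>"


section \<open>Product operations\<close>

text \<open>Functor laws, naturality and the coherence diagrams hold because they hold in
  \<open>\<^bold>S\<^bold>e\<^bold>t\<close> and the forgetful functor is faithful; what has to be required is that the underlying
  set is the cartesian product, that \<open>f \<times> g\<close> is continuous, and that the structure bijections
  of the cartesian structure are homeomorphisms.\<close>

definition product_operation :: "'a prod_op \<Rightarrow> bool" where
  "product_operation T \<longleftrightarrow>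
     (\<forall>X Y. closure_space X \<longrightarrow> closure_space Y \<longrightarrow>
        closure_space (T X Y) \<and> pts (T X Y) = pr_set (pts X) (pts Y)) \<and>
     (\<forall>X X' Y Y' f g. closure_space X \<longrightarrow> closure_space X' \<longrightarrow>
        closure_space Y \<longrightarrow> closure_space Y' \<longrightarrow>
        cl_continuous X X' f \<longrightarrow> cl_continuous Y Y' g \<longrightarrow>
        cl_continuous (T X Y) (T X' Y') (pr_map f g)) \<and>
     (\<forall>X Y Z. closure_space X \<longrightarrow> closure_space Y \<longrightarrow> closure_space Z \<longrightarrow>
        cl_homeo (T (T X Y) Z) (T X (T Y Z)) pr_assoc) \<and>
     (\<forall>X. closure_space X \<longrightarrow>
        cl_homeo (T one_point X) X pr2 \<and> cl_homeo (T X one_point) X pr1) \<and>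
     (\<forall>X Y. closure_space X \<longrightarrow> closure_space Y \<longrightarrow>
        cl_homeo (T X Y) (T Y X) pr_swap)"

definition times_op :: "'a prod_op" where
  "times_op X Y =
     \<lparr>pts = pr_set (pts X) (pts Y),
      clo = (\<lambda>A. {Pr x y | x y. x \<in> pts X \<and> y \<in> pts Y \<and>
        (\<forall>U V. nbhd X x U \<longrightarrow> nbhd Y y V \<longrightarrow> pr_set U V \<inter> A \<noteq> {})})\<rparr>"

definition box_op :: "'a prod_op" where
  "box_op X Y =
     \<lparr>pts = pr_set (pts X) (pts Y),
      clo = (\<lambda>A. {Pr x y | x y. x \<in> pts X \<and> y \<in> pts Y \<and>
        (\<forall>U V. nbhd X x U \<longrightarrow> nbhd Y y V \<longrightarrow>
           (pr_set {x} V \<union> pr_set U {y}) \<inter> A \<noteq> {})})\<rparr>"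


section \<open>Intervals\<close>

record 'a interval_data =
  spc :: "'a space"
  pt0 :: "'a pt"
  pt1 :: "'a pt"
  join :: "'a pt \<Rightarrow> 'a pt \<Rightarrow> 'a pt"

definition interval_for :: "'a prod_op \<Rightarrow> 'a interval_data \<Rightarrow> bool" where
  "interval_for T J \<longleftrightarrow>
     closure_space (spc J) \<and> pt0 J \<in> pts (spc J) \<and> pt1 J \<in> pts (spc J) \<and>
     cl_continuous (T (spc J) (spc J)) (spc J) (\<lambda>p. join J (pr1 p) (pr2 p)) \<and>
     (\<forall>s\<in>pts (spc J). \<forall>t\<in>pts (spc J). join J s t = join J t s) \<and>
     (\<forall>r\<in>pts (spc J). \<forall>s\<in>pts (spc J). \<forall>t\<in>pts (spc J).
        join J (join J r s) t = join J r (join J s t)) \<and>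
     (\<forall>t\<in>pts (spc J). join J (pt0 J) t = t \<and> join J (pt1 J) t = pt1 J)"

definition num_max :: "'a pt \<Rightarrow> 'a pt \<Rightarrow> 'a pt" where
  "num_max s t = Num (max (num_val s) (num_val t))"

definition I_tau :: "'a interval_data" where
  "I_tau =
     \<lparr>spc = \<lparr>pts = Num ` {0..1},
             clo = (\<lambda>A. Num ` (top_of_set {0..1} closure_of (Num -` A)))\<rparr>,
      pt0 = Num 0, pt1 = Num 1, join = num_max\<rparr>"

definition J_top :: "'a interval_data" where
  "J_top =
     \<lparr>spc = \<lparr>pts = {Num 0, Num 1},
             clo = (\<lambda>A. if A = {} then {} else {Num 0, Num 1})\<rparr>,
      pt0 = Num 0, pt1 = Num 1, join = num_max\<rparr>"

definition J_plus :: "'a interval_data" where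
  "J_plus =
     \<lparr>spc = \<lparr>pts = {Num 0, Num 1},
             clo = (\<lambda>A. if Num 0 \<in> A then {Num 0, Num 1} else A)\<rparr>,
      pt0 = Num 0, pt1 = Num 1, join = num_max\<rparr>"

definition J_bot :: "'a interval_data" where
  "J_bot =
     \<lparr>spc = \<lparr>pts = {Num 0, Num 1}, clo = (\<lambda>A. A)\<rparr>,
      pt0 = Num 0, pt1 = Num 1, join = num_max\<rparr>"

definition J_pt :: "'a interval_data" where
  "J_pt = \<lparr>spc = one_point, pt0 = Num 0, pt1 = Num 0, join = num_max\<rparr>"


section \<open>Homotopy\<close>

type_synonym 'a htpy_pair = "'a interval_data \<times> 'a prod_op"

definition interval_pair :: "'a htpy_pair \<Rightarrow> bool" where
  "interval_pair p \<longleftrightarrow> product_operation (snd p) \<and> interval_for (snd p) (fst p)"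

definition elem_homotopic ::
  "'a htpy_pair \<Rightarrow> 'a space \<Rightarrow> 'a space \<Rightarrow> ('a pt \<Rightarrow> 'a pt) \<Rightarrow> ('a pt \<Rightarrow> 'a pt) \<Rightarrow> bool" where
  "elem_homotopic p X Y f g \<longleftrightarrow>
     f \<in> cl_maps X Y \<and> g \<in> cl_maps X Y \<and>
     (\<exists>H. cl_continuous (snd p X (spc (fst p))) Y H \<and>
        (\<forall>x\<in>pts X. H (Pr x (pt0 (fst p))) = f x \<and> H (Pr x (pt1 (fst p))) = g x))"

text \<open>\<open>equivclp\<close> is reflexive on all functions; it is only ever used between elements of
  \<open>cl_maps X Y\<close>, on which it is the generated equivalence relation because
  \<open>elem_homotopic\<close> only relates such elements.\<close>

definition homotopic_by ::
  "'a htpy_pair \<Rightarrow> 'a space \<Rightarrow> 'a space \<Rightarrow> ('a pt \<Rightarrow> 'a pt) \<Rightarrow> ('a pt \<Rightarrow> 'a pt) \<Rightarrow> bool" where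
  "homotopic_by p X Y = equivclp (elem_homotopic p X Y)"

definition le_at :: "'a space \<Rightarrow> 'a space \<Rightarrow> 'a htpy_pair \<Rightarrow> 'a htpy_pair \<Rightarrow> bool" where
  "le_at X Y p q \<longleftrightarrow>
     (\<forall>f\<in>cl_maps X Y. \<forall>g\<in>cl_maps X Y. homotopic_by p X Y f g \<longrightarrow> homotopic_by q X Y f g)"

text \<open>For particular spaces \<open>le_at X Y\<close> need not be antisymmetric (for one-point \<open>X\<close> and
  \<open>Y\<close> all pairs are equivalent). The order that does not depend on \<open>X\<close> and \<open>Y\<close> is the one
  that requires the implication for all of them.\<close>

definition le_uniform :: "'a htpy_pair \<Rightarrow> 'a htpy_pair \<Rightarrow> bool" where
  "le_uniform p q \<longleftrightarrow>
     (\<forall>X Y. closure_space X \<longrightarrow> closure_space Y \<longrightarrow> le_at X Y p q)"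


section \<open>The eight pairs and the diagram\<close>

definition eight_pairs :: "'a htpy_pair set" where
  "eight_pairs =
     {(J_pt, times_op), (J_top, times_op), (J_plus, times_op), (J_top, box_op),
      (I_tau, times_op), (J_plus, box_op), (I_tau, box_op), (J_bot, times_op)}"

definition diagram_edges :: "('a htpy_pair \<times> 'a htpy_pair) set" where
  "diagram_edges =
     {((J_pt, times_op), (J_top, times_op)),
      ((J_top, times_op), (J_plus, times_op)),
      ((J_top, times_op), (J_top, box_op)),
      ((J_plus, times_op), (I_tau, times_op)),
      ((J_plus, times_op), (J_plus, box_op)),
      ((J_top, box_op), (J_plus, box_op)),
      ((I_tau, times_op), (I_tau, box_op)),
      ((J_plus, box_op), (I_tau, box_op)),
      ((I_tau, box_op), (J_bot, times_op))}"

definition pairs_order :: "('a htpy_pair \<times> 'a htpy_pair) set" where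
  "pairs_order = {(p, q). p \<in> eight_pairs \<and> q \<in> eight_pairs \<and> le_uniform p q}"

definition hasse_edges :: "('b \<times> 'b) set \<Rightarrow> ('b \<times> 'b) set" where
  "hasse_edges r =
     {(p, q) \<in> r. p \<noteq> q \<and> \<not> (\<exists>z. z \<noteq> p \<and> z \<noteq> q \<and> (p, z) \<in> r \<and> (z, q) \<in> r)}"

end

(*
  A map out of the inductive product is continuous iff it is separately continuous, and a map into
  the product is continuous iff its components are. The endpoint-preserving continuous maps
  I_tau -> J_+ -> J_top and the continuous identity from the inductive product to the product give
  all edges. Since the diagram is a partial order generated by these edges, its non-relations all
  follow from five of them. Four are witnessed by paths, i.e. maps out of the one-point space.
  The remaining one, (J_top, box) against (I_tau, times), needs a 4-cycle Q: its identity is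
  box-homotopic to a reflection, but a map jointly continuous on Q x I_tau which is the identity at
  one time is the identity at all times, because distinct vertices of Q have distinct minimal
  neighbourhoods and each vertex is the only common point of those of its neighbours and itself.
*)
theory Submission
  imports Defs
begin

section \<open>Neighbourhoods and continuity\<close>

text \<open>Since \<open>le_uniform\<close> quantifies over both spaces, each non-relation may
  choose its own pair of spaces. Paths cannot settle (\<open>J_top\<close>, \<open>box_op\<close>)
  against (\<open>I_tau\<close>, \<open>times_op\<close>): by the unitor, a one-point domain does
  not see the product operation, and every \<open>J_top\<close> path yields an \<open>I_tau\<close>
  path with the same ends. So the domain needs several points and must tell the two products apart.
  On the 4-cycle each vertex separately can be pushed along an edge, which is all that the inductive
  product asks; pushing all vertices together is what joint continuity obstructs. Homotopy is a
  generated equivalence, so zigzags of any length and direction must be excluded. Every negative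
  result therefore rests on a property kept by single elementary steps in both directions, namely
  being equal to one given map (\<open>homotopic_by_eqI\<close>). The closures need not be
  idempotent, so open sets do not determine them. Neighbourhood systems do, and both products are
  defined by them; hence continuity is handled pointwise throughout.\<close>

lemma closure_spaceD:
  assumes "closure_space X"
  shows "clo X {} = {}"
    and "A \<subseteq> pts X \<Longrightarrow> A \<subseteq> clo X A"
    and "A \<subseteq> pts X \<Longrightarrow> clo X A \<subseteq> pts X"
    and "A \<subseteq> pts X \<Longrightarrow> B \<subseteq> pts X \<Longrightarrow> clo X (A \<union> B) = clo X A \<union> clo X B"
  using assms unfolding closure_space_def by simp_all

lemma clo_mono:
  assumes "closure_space X" "A \<subseteq> B" "B \<subseteq> pts X"
  shows "clo X A \<subseteq> clo X B"
proof -
  have "clo X (A \<union> B) = clo X A \<union> clo X B"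
    using assms by (intro closure_spaceD(4)) auto
  moreover have "A \<union> B = B" using assms by blast
  ultimately show ?thesis by auto
qed

lemma nbhd_pts:
  assumes "closure_space X" "x \<in> pts X"
  shows "nbhd X x (pts X)"
  using assms by (simp add: nbhd_def closure_spaceD)

lemma nbhd_mem:
  assumes "closure_space X" "nbhd X x U"
  shows "x \<in> U"
  using assms closure_spaceD(2)[OF assms(1), of "pts X - U"] by (auto simp: nbhd_def)

lemma nbhd_Int:
  assumes "closure_space X" "nbhd X x U" "nbhd X x V"
  shows "nbhd X x (U \<inter> V)"
proof -
  have "pts X - U \<inter> V = (pts X - U) \<union> (pts X - V)" by blast
  then have "clo X (pts X - U \<inter> V) = clo X (pts X - U) \<union> clo X (pts X - V)"
    using closure_spaceD(4)[OF assms(1)] by simp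
  then show ?thesis using assms by (auto simp: nbhd_def)
qed

text \<open>If \<open>x\<close> is outside \<open>clo X A\<close>, then \<open>pts X - A\<close> is
  itself a neighbourhood of \<open>x\<close>, and it misses \<open>A\<close>. The other direction is
  monotonicity of the closure.\<close>

lemma mem_clo_iff_nbhd:
  assumes "closure_space X" "A \<subseteq> pts X"
  shows "x \<in> clo X A \<longleftrightarrow> x \<in> pts X \<and> (\<forall>U. nbhd X x U \<longrightarrow> U \<inter> A \<noteq> {})"
proof (intro iffI conjI allI impI)
  assume x: "x \<in> clo X A"
  show "x \<in> pts X" using x closure_spaceD(3)[OF assms] by blast
  fix U assume U: "nbhd X x U"
  show "U \<inter> A \<noteq> {}"
  proof
    assume "U \<inter> A = {}"
    then have "clo X A \<subseteq> clo X (pts X - U)"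
      using assms by (intro clo_mono) auto
    then show False using x U by (auto simp: nbhd_def)
  qed
next
  assume *: "x \<in> pts X \<and> (\<forall>U. nbhd X x U \<longrightarrow> U \<inter> A \<noteq> {})"
  show "x \<in> clo X A"
  proof (rule ccontr)
    assume "x \<notin> clo X A"
    moreover have "pts X - (pts X - A) = A" using assms by blast
    ultimately have "nbhd X x (pts X - A)" using * by (simp add: nbhd_def)
    then show False using * by blast
  qed
qed

lemma cl_continuousI:
  assumes X: "closure_space X" and Y: "closure_space Y" and f: "f \<in> pts X \<rightarrow> pts Y"
    and nb: "\<And>x V. x \<in> pts X \<Longrightarrow> nbhd Y (f x) V \<Longrightarrow> \<exists>U. nbhd X x U \<and> f ` U \<subseteq> V"
  shows "cl_continuous X Y f"
  unfolding cl_continuous_def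
proof (intro conjI allI impI f image_subsetI)
  fix A x assume A: "A \<subseteq> pts X" and x: "x \<in> clo X A"
  have fA: "f ` A \<subseteq> pts Y" using f A by blast
  have xX: "x \<in> pts X" using x closure_spaceD(3)[OF X A] by blast
  show "f x \<in> clo Y (f ` A)"
    unfolding mem_clo_iff_nbhd[OF Y fA]
  proof (intro conjI allI impI)
    show "f x \<in> pts Y" using xX f by blast
    fix V assume "nbhd Y (f x) V"
    then obtain U where "nbhd X x U" "f ` U \<subseteq> V" using nb xX by blast
    then show "V \<inter> f ` A \<noteq> {}" using x unfolding mem_clo_iff_nbhd[OF X A] by blast
  qed
qed

text \<open>Converse of \<open>cl_continuousI\<close>. The full preimage of \<open>V\<close> works,
  because its complement is mapped into the complement of \<open>V\<close>.\<close>

lemma cl_continuous_nbhd: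
  assumes X: "closure_space X" and Y: "closure_space Y" and f: "cl_continuous X Y f"
    and x: "x \<in> pts X" and V: "nbhd Y (f x) V"
  obtains U where "nbhd X x U" "f ` U \<subseteq> V"
proof
  let ?U = "{u \<in> pts X. f u \<in> V}"
  have fX: "f \<in> pts X \<rightarrow> pts Y" using f by (simp add: cl_continuous_def)
  have "x \<notin> clo X (pts X - ?U)"
  proof
    assume "x \<in> clo X (pts X - ?U)"
    then have "f x \<in> clo Y (f ` (pts X - ?U))"
      using f unfolding cl_continuous_def by blast
    also have "\<dots> \<subseteq> clo Y (pts Y - V)"
      using fX by (intro clo_mono[OF Y]) auto
    finally show False using V by (auto simp: nbhd_def)
  qed
  then show "nbhd X x ?U" using x by (auto simp: nbhd_def)
  show "f ` ?U \<subseteq> V" by auto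
qed

text \<open>Lets restricted functions, as \<open>cl_maps\<close> demands them, be exchanged for the
  plain formulas that they restrict.\<close>

lemma cl_continuous_cong:
  assumes X: "closure_space X" and eq: "\<And>x. x \<in> pts X \<Longrightarrow> f x = g x"
  shows "cl_continuous X Y f \<longleftrightarrow> cl_continuous X Y g"
proof -
  have im: "f ` A = g ` A" if "A \<subseteq> pts X" for A
    using that by (intro image_cong refl eq) blast
  have "f ` clo X A \<subseteq> clo Y (f ` A) \<longleftrightarrow> g ` clo X A \<subseteq> clo Y (g ` A)" if "A \<subseteq> pts X" for A
    using im[OF that] im[OF closure_spaceD(3)[OF X that]] by simp
  moreover have "f \<in> pts X \<rightarrow> pts Y \<longleftrightarrow> g \<in> pts X \<rightarrow> pts Y" using eq by (simp add: Pi_iff)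
  ultimately show ?thesis unfolding cl_continuous_def by simp
qed

lemma cl_continuous_pts: "cl_continuous X Y f \<Longrightarrow> x \<in> pts X \<Longrightarrow> f x \<in> pts Y"
  by (auto simp: cl_continuous_def)

lemma cl_continuous_clo:
  "cl_continuous X Y f \<Longrightarrow> A \<subseteq> pts X \<Longrightarrow> f ` clo X A \<subseteq> clo Y (f ` A)"
  by (simp add: cl_continuous_def)

lemma cl_continuous_id: "cl_continuous X X (\<lambda>x. x)"
  by (auto simp: cl_continuous_def)

lemma cl_continuous_compose:
  assumes "cl_continuous X Y f" "cl_continuous Y Z g"
  shows "cl_continuous X Z (\<lambda>x. g (f x))"
  unfolding cl_continuous_def
proof (intro conjI allI impI)
  show "(\<lambda>x. g (f x)) \<in> pts X \<rightarrow> pts Z"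
    by (intro funcsetI cl_continuous_pts[OF assms(2)] cl_continuous_pts[OF assms(1)])
  fix A assume A: "A \<subseteq> pts X"
  have "f ` A \<subseteq> pts Y" using A cl_continuous_pts[OF assms(1)] by blast
  then have "g ` clo Y (f ` A) \<subseteq> clo Z (g ` f ` A)"
    using assms(2) by (simp add: cl_continuous_def)
  moreover have "f ` clo X A \<subseteq> clo Y (f ` A)"
    using assms(1) A by (simp add: cl_continuous_def)
  ultimately show "(\<lambda>x. g (f x)) ` clo X A \<subseteq> clo Z ((\<lambda>x. g (f x)) ` A)"
    by (auto simp: image_image)
qed

lemma cl_continuous_const:
  assumes X: "closure_space X" and Y: "closure_space Y" and y: "y \<in> pts Y"
  shows "cl_continuous X Y (\<lambda>x. y)"
proof (rule cl_continuousI[OF X Y])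
  show "\<exists>U. nbhd X x U \<and> (\<lambda>x. y) ` U \<subseteq> V" if "x \<in> pts X" "nbhd Y y V" for x V
    using that nbhd_pts[OF X] nbhd_mem[OF Y] by (intro exI[of _ "pts X"]) auto
qed (use y in auto)

section \<open>The two products\<close>

lemma Pr_in_pr_set [simp]: "Pr a b \<in> pr_set A B \<longleftrightarrow> a \<in> A \<and> b \<in> B"
  by (auto simp: pr_set_def)

lemma pr_setE:
  assumes "p \<in> pr_set A B"
  obtains a b where "p = Pr a b" "a \<in> A" "b \<in> B"
  using assms by (auto simp: pr_set_def)

lemma pr_set_subset_iff: "pr_set A B \<subseteq> W \<longleftrightarrow> (\<forall>a\<in>A. \<forall>b\<in>B. Pr a b \<in> W)"
  by (auto simp: pr_set_def)

lemma pr_set_disjoint_iff: "pr_set A B \<inter> W = {} \<longleftrightarrow> (\<forall>a\<in>A. \<forall>b\<in>B. Pr a b \<notin> W)"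
  by (auto simp: pr_set_def)

section \<open>Neighbourhood bases and closure axioms of the two products\<close>

lemma pts_times_op [simp]: "pts (times_op X Y) = pr_set (pts X) (pts Y)"
  by (simp add: times_op_def)

lemma pts_box_op [simp]: "pts (box_op X Y) = pr_set (pts X) (pts Y)"
  by (simp add: box_op_def)

text \<open>Negating the closure condition for the complement of \<open>W\<close> produces a
  rectangle that misses this complement. For \<open>box_op\<close> the same argument yields a cross
  instead of a rectangle.\<close>

lemma nbhd_times_op:
  "nbhd (times_op X Y) (Pr x y) W \<longleftrightarrow>
     W \<subseteq> pr_set (pts X) (pts Y) \<and> (\<exists>U V. nbhd X x U \<and> nbhd Y y V \<and> pr_set U V \<subseteq> W)"
proof -
  have "pr_set U V \<inter> (pr_set (pts X) (pts Y) - W) = {} \<longleftrightarrow> pr_set U V \<subseteq> W"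
    if "nbhd X x U" "nbhd Y y V" for U V
    using that unfolding pr_set_disjoint_iff pr_set_subset_iff by (auto simp: nbhd_def)
  then show ?thesis
    unfolding nbhd_def[of "times_op X Y"] pts_times_op
    by (auto simp: times_op_def) (auto simp: nbhd_def)
qed

lemma nbhd_box_op:
  "nbhd (box_op X Y) (Pr x y) W \<longleftrightarrow>
     W \<subseteq> pr_set (pts X) (pts Y) \<and>
     (\<exists>U V. nbhd X x U \<and> nbhd Y y V \<and> pr_set {x} V \<union> pr_set U {y} \<subseteq> W)"
proof -
  have "(pr_set {x} V \<union> pr_set U {y}) \<inter> (pr_set (pts X) (pts Y) - W) = {} \<longleftrightarrow>
      pr_set {x} V \<union> pr_set U {y} \<subseteq> W"
    if "nbhd X x U" "nbhd Y y V" for U V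
    using that unfolding Int_Un_distrib2 Un_empty Un_subset_iff pr_set_disjoint_iff pr_set_subset_iff
    by (auto simp: nbhd_def)
  then show ?thesis
    unfolding nbhd_def[of "box_op X Y"] pts_box_op
    by (auto simp: box_op_def) (auto simp: nbhd_def)
qed

lemma closure_space_times_op:
  assumes X: "closure_space X" and Y: "closure_space Y"
  shows "closure_space (times_op X Y)"
  unfolding closure_space_def
proof (intro conjI allI impI)
  show "clo (times_op X Y) {} = {}"
    using nbhd_pts[OF X] nbhd_pts[OF Y] by (auto simp: times_op_def)
  fix A assume A: "A \<subseteq> pts (times_op X Y)"
  show "A \<subseteq> clo (times_op X Y) A"
  proof
    fix p assume p: "p \<in> A"
    then obtain x y where "p = Pr x y" "x \<in> pts X" "y \<in> pts Y"
      using subsetD[OF A p] by (auto elim!: pr_setE)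
    then show "p \<in> clo (times_op X Y) A"
      using p nbhd_mem[OF X] nbhd_mem[OF Y]
      by (auto simp: times_op_def disjoint_iff) (metis Pr_in_pr_set)
  qed
  show "clo (times_op X Y) A \<subseteq> pts (times_op X Y)" by (auto simp: times_op_def)
  fix B assume B: "B \<subseteq> pts (times_op X Y)"
  show "clo (times_op X Y) (A \<union> B) = clo (times_op X Y) A \<union> clo (times_op X Y) B"
  proof
    show "clo (times_op X Y) (A \<union> B) \<subseteq> clo (times_op X Y) A \<union> clo (times_op X Y) B"
    proof (rule subsetI, rule ccontr)
      fix p assume p: "p \<in> clo (times_op X Y) (A \<union> B)"
        and n: "p \<notin> clo (times_op X Y) A \<union> clo (times_op X Y) B"
      then obtain x y where xy: "p = Pr x y" "x \<in> pts X" "y \<in> pts Y" by (auto simp: times_op_def)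
      obtain U V where 1: "nbhd X x U" "nbhd Y y V" "pr_set U V \<inter> A = {}"
        using n xy by (auto simp: times_op_def)
      obtain U' V' where 2: "nbhd X x U'" "nbhd Y y V'" "pr_set U' V' \<inter> B = {}"
        using n xy by (auto simp: times_op_def)
      \<comment> \<open>Intersecting the two pairs of neighbourhoods gives a single rectangle, which
        has to meet \<open>A \<union> B\<close> but misses both sets.\<close>
      have "pr_set (U \<inter> U') (V \<inter> V') \<inter> (A \<union> B) \<noteq> {}"
        using p xy nbhd_Int[OF X 1(1) 2(1)] nbhd_Int[OF Y 1(2) 2(2)] by (auto simp: times_op_def)
      then show False using 1(3) 2(3) by (auto simp: disjoint_iff elim!: pr_setE)
    qed
  qed (fastforce simp: times_op_def)
qed

lemma closure_space_box_op:
  assumes X: "closure_space X" and Y: "closure_space Y"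
  shows "closure_space (box_op X Y)"
  unfolding closure_space_def
proof (intro conjI allI impI)
  show "clo (box_op X Y) {} = {}"
    using nbhd_pts[OF X] nbhd_pts[OF Y] by (auto simp: box_op_def)
  fix A assume A: "A \<subseteq> pts (box_op X Y)"
  show "A \<subseteq> clo (box_op X Y) A"
  proof
    fix p assume p: "p \<in> A"
    then obtain x y where "p = Pr x y" "x \<in> pts X" "y \<in> pts Y"
      using subsetD[OF A p] by (auto elim!: pr_setE)
    then show "p \<in> clo (box_op X Y) A"
      using p nbhd_mem[OF X]
      by (auto simp: box_op_def disjoint_iff) (metis Pr_in_pr_set singletonI)
  qed
  show "clo (box_op X Y) A \<subseteq> pts (box_op X Y)" by (auto simp: box_op_def)
  fix B assume B: "B \<subseteq> pts (box_op X Y)"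
  show "clo (box_op X Y) (A \<union> B) = clo (box_op X Y) A \<union> clo (box_op X Y) B"
  proof
    show "clo (box_op X Y) (A \<union> B) \<subseteq> clo (box_op X Y) A \<union> clo (box_op X Y) B"
    proof (rule subsetI, rule ccontr)
      fix p assume p: "p \<in> clo (box_op X Y) (A \<union> B)"
        and n: "p \<notin> clo (box_op X Y) A \<union> clo (box_op X Y) B"
      then obtain x y where xy: "p = Pr x y" "x \<in> pts X" "y \<in> pts Y" by (auto simp: box_op_def)
      obtain U V where 1: "nbhd X x U" "nbhd Y y V" "(pr_set {x} V \<union> pr_set U {y}) \<inter> A = {}"
        using n xy by (auto simp: box_op_def)
      obtain U' V' where 2: "nbhd X x U'" "nbhd Y y V'" "(pr_set {x} V' \<union> pr_set U' {y}) \<inter> B = {}"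
        using n xy by (auto simp: box_op_def)
      have "(pr_set {x} (V \<inter> V') \<union> pr_set (U \<inter> U') {y}) \<inter> (A \<union> B) \<noteq> {}"
        using p xy nbhd_Int[OF X 1(1) 2(1)] nbhd_Int[OF Y 1(2) 2(2)] by (auto simp: box_op_def)
      then show False using 1(3) 2(3) by (auto simp: disjoint_iff elim!: pr_setE)
    qed
  qed (fastforce simp: box_op_def)
qed

section \<open>Continuity criteria for maps into and out of the products\<close>

lemma cl_continuous_pr1_times_op:
  assumes X: "closure_space X" and Y: "closure_space Y"
  shows "cl_continuous (times_op X Y) X pr1"
proof (rule cl_continuousI[OF closure_space_times_op[OF X Y] X])
  fix p V assume "p \<in> pts (times_op X Y)" and V: "nbhd X (pr1 p) V"
  then obtain x y where xy: "p = Pr x y" "x \<in> pts X" "y \<in> pts Y" by (auto elim: pr_setE)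
  have "V \<subseteq> pts X" using V by (simp add: nbhd_def)
  then have "nbhd (times_op X Y) p (pr_set V (pts Y))"
    using V xy nbhd_pts[OF Y] by (auto simp: nbhd_times_op pr_set_def)
  then show "\<exists>U. nbhd (times_op X Y) p U \<and> pr1 ` U \<subseteq> V" by (auto simp: pr_set_def)
qed (auto simp: pr_set_def)

lemma cl_continuous_pr2_times_op:
  assumes X: "closure_space X" and Y: "closure_space Y"
  shows "cl_continuous (times_op X Y) Y pr2"
proof (rule cl_continuousI[OF closure_space_times_op[OF X Y] Y])
  fix p V assume "p \<in> pts (times_op X Y)" and V: "nbhd Y (pr2 p) V"
  then obtain x y where xy: "p = Pr x y" "x \<in> pts X" "y \<in> pts Y" by (auto elim: pr_setE)
  have "V \<subseteq> pts Y" using V by (simp add: nbhd_def)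
  then have "nbhd (times_op X Y) p (pr_set (pts X) V)"
    using V xy nbhd_pts[OF X] by (auto simp: nbhd_times_op pr_set_def)
  then show "\<exists>U. nbhd (times_op X Y) p U \<and> pr2 ` U \<subseteq> V" by (auto simp: pr_set_def)
qed (auto simp: pr_set_def)

text \<open>With the two projections this makes \<open>times_op\<close> the categorical product. The
  structure maps are tuples of projections, so their continuity will need no further neighbourhood
  argument.\<close>

lemma cl_continuous_into_times_op:
  assumes W: "closure_space W" and X: "closure_space X" and Y: "closure_space Y"
    and f: "cl_continuous W X f" and g: "cl_continuous W Y g"
  shows "cl_continuous W (times_op X Y) (\<lambda>w. Pr (f w) (g w))"
proof (rule cl_continuousI[OF W closure_space_times_op[OF X Y]])
  show "(\<lambda>w. Pr (f w) (g w)) \<in> pts W \<rightarrow> pts (times_op X Y)"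
    using f g by (auto simp: cl_continuous_def)
  fix w N assume w: "w \<in> pts W" and "nbhd (times_op X Y) (Pr (f w) (g w)) N"
  then obtain U V where UV: "nbhd X (f w) U" "nbhd Y (g w) V" "pr_set U V \<subseteq> N"
    by (auto simp: nbhd_times_op)
  obtain U' where U': "nbhd W w U'" "f ` U' \<subseteq> U" using cl_continuous_nbhd[OF W X f w UV(1)] .
  obtain V' where V': "nbhd W w V'" "g ` V' \<subseteq> V" using cl_continuous_nbhd[OF W Y g w UV(2)] .
  have "(\<lambda>w. Pr (f w) (g w)) ` (U' \<inter> V') \<subseteq> N"
    using U'(2) V'(2) UV(3) unfolding pr_set_subset_iff by blast
  then show "\<exists>U. nbhd W w U \<and> (\<lambda>w. Pr (f w) (g w)) ` U \<subseteq> N"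
    using nbhd_Int[OF W U'(1) V'(1)] by blast
qed

text \<open>Each of the two lines through a point supplies one arm of a cross-shaped neighbourhood,
  and nothing is asked off the lines.\<close>

lemma cl_continuous_on_box_op:
  assumes X: "closure_space X" and Y: "closure_space Y" and Z: "closure_space Z"
    and H1: "\<And>x. x \<in> pts X \<Longrightarrow> cl_continuous Y Z (\<lambda>y. H (Pr x y))"
    and H2: "\<And>y. y \<in> pts Y \<Longrightarrow> cl_continuous X Z (\<lambda>x. H (Pr x y))"
  shows "cl_continuous (box_op X Y) Z H"
proof (rule cl_continuousI[OF closure_space_box_op[OF X Y] Z])
  show "H \<in> pts (box_op X Y) \<rightarrow> pts Z"
    using H1 by (fastforce elim!: pr_setE simp: cl_continuous_def)
  fix p N assume "p \<in> pts (box_op X Y)" and N: "nbhd Z (H p) N"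
  then obtain x y where xy: "p = Pr x y" "x \<in> pts X" "y \<in> pts Y" by (auto elim: pr_setE)
  obtain U where U: "nbhd X x U" "(\<lambda>x. H (Pr x y)) ` U \<subseteq> N"
    using cl_continuous_nbhd[OF X Z H2[OF xy(3)] xy(2)] N xy by blast
  obtain V where V: "nbhd Y y V" "(\<lambda>y. H (Pr x y)) ` V \<subseteq> N"
    using cl_continuous_nbhd[OF Y Z H1[OF xy(2)] xy(3)] N xy by blast
  have "nbhd (box_op X Y) p (pr_set {x} V \<union> pr_set U {y})"
    using U(1) V(1) xy unfolding xy(1) nbhd_box_op
    by (intro conjI exI[of _ U] exI[of _ V]) (auto simp: nbhd_def pr_set_subset_iff)
  moreover have "H ` (pr_set {x} V \<union> pr_set U {y}) \<subseteq> N" using U V by (auto simp: pr_set_def)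
  ultimately show "\<exists>U. nbhd (box_op X Y) p U \<and> H ` U \<subseteq> N" by blast
qed

text \<open>One arm of a basic cross lies on the line over \<open>x\<close>. These inclusions of
  lines are the building blocks for maps into \<open>box_op\<close>, as the projections are for
  \<open>times_op\<close>.\<close>

lemma cl_continuous_section1_box_op:
  assumes X: "closure_space X" and Y: "closure_space Y" and x: "x \<in> pts X"
  shows "cl_continuous Y (box_op X Y) (Pr x)"
proof (rule cl_continuousI[OF Y closure_space_box_op[OF X Y]])
  fix y N assume "nbhd (box_op X Y) (Pr x y) N"
  then show "\<exists>V. nbhd Y y V \<and> Pr x ` V \<subseteq> N" unfolding nbhd_box_op Un_subset_iff pr_set_subset_iff by blast
qed (use x in auto)

lemma cl_continuous_section2_box_op:
  assumes X: "closure_space X" and Y: "closure_space Y" and y: "y \<in> pts Y"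
  shows "cl_continuous X (box_op X Y) (\<lambda>x. Pr x y)"
proof (rule cl_continuousI[OF X closure_space_box_op[OF X Y]])
  fix x N assume "nbhd (box_op X Y) (Pr x y) N"
  then show "\<exists>U. nbhd X x U \<and> (\<lambda>x. Pr x y) ` U \<subseteq> N"
    unfolding nbhd_box_op Un_subset_iff pr_set_subset_iff by blast
qed (use y in auto)

lemma cl_continuous_box_times:
  assumes X: "closure_space X" and Y: "closure_space Y"
  shows "cl_continuous (box_op X Y) (times_op X Y) (\<lambda>p. p)"
proof (rule cl_continuous_on_box_op[OF X Y closure_space_times_op[OF X Y]])
  show "cl_continuous Y (times_op X Y) (\<lambda>y. Pr x y)" if "x \<in> pts X" for x
    using cl_continuous_into_times_op[OF Y X Y cl_continuous_const[OF Y X that] cl_continuous_id] .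
  show "cl_continuous X (times_op X Y) (\<lambda>x. Pr x y)" if "y \<in> pts Y" for y
    using cl_continuous_into_times_op[OF X X Y cl_continuous_id cl_continuous_const[OF X Y that]] .
qed

section \<open>Both products are product operations\<close>

lemma cl_homeoI:
  assumes "cl_continuous X Y f" "cl_continuous Y X g"
    "\<And>x. x \<in> pts X \<Longrightarrow> g (f x) = x" "\<And>y. y \<in> pts Y \<Longrightarrow> f (g y) = y"
  shows "cl_homeo X Y f"
  using assms unfolding cl_homeo_def by blast

lemma closure_space_one_point: "closure_space one_point"
  by (simp add: closure_space_def one_point_def)

lemma pts_one_point: "pts one_point = {Num 0}"
  by (simp add: one_point_def)

lemma product_operationD:
  assumes "product_operation T" "closure_space X" "closure_space Y"
  shows "pts (T X Y) = pr_set (pts X) (pts Y)"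
    and "closure_space X' \<Longrightarrow> closure_space Y' \<Longrightarrow> cl_continuous X X' f \<Longrightarrow>
      cl_continuous Y Y' g \<Longrightarrow> cl_continuous (T X Y) (T X' Y') (pr_map f g)"
    and "cl_homeo (T one_point X) X pr2"
  using assms unfolding product_operation_def by simp_all

lemma product_operation_times_op: "product_operation times_op"
proof -
  note cs = closure_space_times_op
  note into = cl_continuous_into_times_op
  note pr1 = cl_continuous_pr1_times_op and pr2 = cl_continuous_pr2_times_op
  note comp = cl_continuous_compose
  show ?thesis
    unfolding product_operation_def
  proof (intro conjI allI impI)
    fix X X' Y Y' :: "'a space" and f g
    assume X: "closure_space X" and X': "closure_space X'" and Y: "closure_space Y"
      and Y': "closure_space Y'" and f: "cl_continuous X X' f" and g: "cl_continuous Y Y' g"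
    show "cl_continuous (times_op X Y) (times_op X' Y') (pr_map f g)"
      using into[OF cs[OF X Y] X' Y' comp[OF pr1[OF X Y] f] comp[OF pr2[OF X Y] g]]
      by (simp add: pr_map_def[abs_def])
  next
    fix X Y Z :: "'a space"
    assume X: "closure_space X" and Y: "closure_space Y" and Z: "closure_space Z"
    note XY = cs[OF X Y] and YZ = cs[OF Y Z]
    note S = cs[OF XY Z] and T = cs[OF X YZ]
    note p1 = pr1[OF XY Z] and p2 = pr2[OF XY Z] and q1 = pr1[OF X YZ] and q2 = pr2[OF X YZ]
    show "cl_homeo (times_op (times_op X Y) Z) (times_op X (times_op Y Z)) pr_assoc"
    proof (rule cl_homeoI)
      show "cl_continuous (times_op (times_op X Y) Z) (times_op X (times_op Y Z)) pr_assoc"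
        unfolding pr_assoc_def[abs_def]
        by (intro into S X Y Z YZ comp[OF p1 pr1] comp[OF p1 pr2] p2)
      show "cl_continuous (times_op X (times_op Y Z)) (times_op (times_op X Y) Z)
          (\<lambda>p. Pr (Pr (pr1 p) (pr1 (pr2 p))) (pr2 (pr2 p)))"
        by (intro into T X Y Z XY comp[OF q2 pr1] comp[OF q2 pr2] q1)
    qed (auto simp: pr_assoc_def elim!: pr_setE)
  next
    fix X :: "'a space" assume X: "closure_space X"
    note P = closure_space_one_point
    have z: "Num 0 \<in> pts one_point" by (simp add: pts_one_point)
    show "cl_homeo (times_op one_point X) X pr2"
      by (rule cl_homeoI[OF pr2[OF P X] into[OF X P X cl_continuous_const[OF X P z] cl_continuous_id]])
        (auto simp: pts_one_point elim!: pr_setE)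
    show "cl_homeo (times_op X one_point) X pr1"
      by (rule cl_homeoI[OF pr1[OF X P] into[OF X X P cl_continuous_id cl_continuous_const[OF X P z]]])
        (auto simp: pts_one_point elim!: pr_setE)
  next
    fix X Y :: "'a space" assume X: "closure_space X" and Y: "closure_space Y"
    show "cl_homeo (times_op X Y) (times_op Y X) pr_swap"
      unfolding pr_swap_def[abs_def]
      by (rule cl_homeoI[OF into[OF cs[OF X Y] Y X pr2[OF X Y] pr1[OF X Y]]
            into[OF cs[OF Y X] X Y pr2[OF Y X] pr1[OF Y X]]])
        (auto elim!: pr_setE)
  qed (simp_all add: cs)
qed

text \<open>Fixing all coordinates but one turns a structure map into a composite of line
  inclusions. For the associator, with three factors, the separate continuity criterion is applied
  once more to the remaining pair.\<close>

lemma product_operation_box_op: "product_operation box_op"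
proof -
  note cs = closure_space_box_op
  note sep = cl_continuous_on_box_op
  note s1 = cl_continuous_section1_box_op and s2 = cl_continuous_section2_box_op
  note comp = cl_continuous_compose
  show ?thesis
    unfolding product_operation_def
  proof (intro conjI allI impI)
    fix X X' Y Y' :: "'a space" and f g
    assume X: "closure_space X" and X': "closure_space X'" and Y: "closure_space Y"
      and Y': "closure_space Y'" and f: "cl_continuous X X' f" and g: "cl_continuous Y Y' g"
    show "cl_continuous (box_op X Y) (box_op X' Y') (pr_map f g)"
      using comp[OF g s1[OF X' Y' cl_continuous_pts[OF f]]]
        comp[OF f s2[OF X' Y' cl_continuous_pts[OF g]]]
      by (intro sep X Y cs[OF X' Y']) (simp_all add: pr_map_def)
  next
    fix X Y Z :: "'a space"
    assume X: "closure_space X" and Y: "closure_space Y" and Z: "closure_space Z"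
    note XY = cs[OF X Y] and YZ = cs[OF Y Z]
    show "cl_homeo (box_op (box_op X Y) Z) (box_op X (box_op Y Z)) pr_assoc"
    proof (rule cl_homeoI)
      show "cl_continuous (box_op (box_op X Y) Z) (box_op X (box_op Y Z)) pr_assoc"
      proof (rule sep[OF XY Z cs[OF X YZ]])
        fix p assume "p \<in> pts (box_op X Y)"
        then obtain a b where "p = Pr a b" "a \<in> pts X" "b \<in> pts Y" by (auto elim: pr_setE)
        then show "cl_continuous Z (box_op X (box_op Y Z)) (\<lambda>c. pr_assoc (Pr p c))"
          using comp[OF s1[OF Y Z] s1[OF X YZ]] by (simp add: pr_assoc_def)
      next
        fix c assume c: "c \<in> pts Z"
        show "cl_continuous (box_op X Y) (box_op X (box_op Y Z)) (\<lambda>p. pr_assoc (Pr p c))"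
          using comp[OF s2[OF Y Z c] s1[OF X YZ]] s2[OF X YZ] c
          by (intro sep[OF X Y cs[OF X YZ]]) (simp_all add: pr_assoc_def)
      qed
      let ?g = "\<lambda>p. Pr (Pr (pr1 p) (pr1 (pr2 p))) (pr2 (pr2 p))"
      show "cl_continuous (box_op X (box_op Y Z)) (box_op (box_op X Y) Z) ?g"
      proof (rule sep[OF X YZ cs[OF XY Z]])
        fix p assume "p \<in> pts (box_op Y Z)"
        then obtain b c where "p = Pr b c" "b \<in> pts Y" "c \<in> pts Z" by (auto elim: pr_setE)
        then show "cl_continuous X (box_op (box_op X Y) Z) (\<lambda>a. ?g (Pr a p))"
          using comp[OF s2[OF X Y] s2[OF XY Z]] by simp
      next
        fix a assume a: "a \<in> pts X"
        show "cl_continuous (box_op Y Z) (box_op (box_op X Y) Z) (\<lambda>p. ?g (Pr a p))"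
          using comp[OF s1[OF X Y a] s2[OF XY Z]] s1[OF XY Z] a
          by (intro sep[OF Y Z cs[OF XY Z]]) simp_all
      qed
    qed (auto simp: pr_assoc_def elim!: pr_setE)
  next
    fix X :: "'a space" assume X: "closure_space X"
    note P = closure_space_one_point
    have z: "Num 0 \<in> pts one_point" by (simp add: pts_one_point)
    have pr2: "cl_continuous (box_op one_point X) X pr2"
      using comp[OF cl_continuous_box_times cl_continuous_pr2_times_op] P X by blast
    have pr1: "cl_continuous (box_op X one_point) X pr1"
      using comp[OF cl_continuous_box_times cl_continuous_pr1_times_op] P X by blast
    show "cl_homeo (box_op one_point X) X pr2"
      by (rule cl_homeoI[OF pr2 s1[OF P X z]]) (auto simp: pts_one_point elim!: pr_setE)
    show "cl_homeo (box_op X one_point) X pr1"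
      by (rule cl_homeoI[OF pr1 s2[OF X P z]]) (auto simp: pts_one_point elim!: pr_setE)
  next
    have sw: "cl_continuous (box_op X Y) (box_op Y X) pr_swap"
      if X: "closure_space X" and Y: "closure_space Y" for X Y :: "'a space"
      using s2[OF Y X] s1[OF Y X] by (intro sep[OF X Y cs[OF Y X]]) (simp_all add: pr_swap_def)
    fix X Y :: "'a space" assume X: "closure_space X" and Y: "closure_space Y"
    show "cl_homeo (box_op X Y) (box_op Y X) pr_swap"
      by (rule cl_homeoI[OF sw[OF X Y] sw[OF Y X]]) (auto simp: pr_swap_def elim!: pr_setE)
  qed (simp_all add: cs)
qed

section \<open>Intervals\<close>

text \<open>Precompose the join with the continuous identity from \<open>box_op\<close> to
  \<open>times_op\<close>. Thus the five intervals need checking for \<open>times_op\<close>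
  only.\<close>

lemma interval_for_box_op:
  assumes J: "interval_for times_op J"
  shows "interval_for box_op J"
proof -
  have S: "closure_space (spc J)" using J by (simp add: interval_for_def)
  have "cl_continuous (times_op (spc J) (spc J)) (spc J) (\<lambda>p. join J (pr1 p) (pr2 p))"
    using J by (simp add: interval_for_def)
  from cl_continuous_compose[OF cl_continuous_box_times[OF S S] this]
  show ?thesis using J unfolding interval_for_def by (elim conjE, intro conjI)
qed

text \<open>The algebraic laws are those of \<open>max\<close>; the bounds 0 and 1 on the points
  make \<open>Num 0\<close> neutral and \<open>Num 1\<close> absorbing. Only continuity depends on
  the closure.\<close>

lemma interval_for_num_max:
  assumes "closure_space S" "pts S \<subseteq> Num ` {0..1}" "Num 0 \<in> pts S" "Num 1 \<in> pts S"
    and "cl_continuous (times_op S S) S (\<lambda>p. num_max (pr1 p) (pr2 p))"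
  shows "interval_for times_op \<lparr>spc = S, pt0 = Num 0, pt1 = Num 1, join = num_max\<rparr>"
  using assms unfolding interval_for_def
  by (auto simp: num_max_def max.commute max.left_commute max_def)

section \<open>The two-point intervals\<close>

lemma closure_space_J_top: "closure_space (spc J_top)"
  by (auto simp: closure_space_def J_top_def)

lemma pts_J_top [simp]: "pts (spc J_top) = {Num 0, Num 1}"
  by (simp add: J_top_def)

lemma cl_continuous_into_J_top:
  assumes "closure_space X" "f \<in> pts X \<rightarrow> {Num 0, Num 1}"
  shows "cl_continuous X (spc J_top) f"
  unfolding cl_continuous_def
proof (intro conjI allI impI)
  show "f \<in> pts X \<rightarrow> pts (spc J_top)" using assms(2) by simp
  fix A assume A: "A \<subseteq> pts X"
  show "f ` clo X A \<subseteq> clo (spc J_top) (f ` A)"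
  proof (cases "A = {}")
    case True
    then show ?thesis using closure_spaceD(1)[OF assms(1)] by simp
  next
    case False
    have "f ` clo X A \<subseteq> {Num 0, Num 1}"
      using assms(2) closure_spaceD(3)[OF assms(1) A] by blast
    then show ?thesis using False by (simp add: J_top_def)
  qed
qed

lemma interval_for_J_top: "interval_for times_op J_top"
proof -
  have "cl_continuous (times_op (spc J_top) (spc J_top)) (spc J_top) (\<lambda>p. num_max (pr1 p) (pr2 p))"
    by (intro cl_continuous_into_J_top closure_space_times_op closure_space_J_top)
      (auto simp: num_max_def elim!: pr_setE)
  from interval_for_num_max[OF closure_space_J_top _ _ _ this] show ?thesis by (simp add: J_top_def)
qed

lemma closure_space_J_plus: "closure_space (spc J_plus)"
  by (auto simp: closure_space_def J_plus_def)

lemma pts_J_plus [simp]: "pts (spc J_plus) = {Num 0, Num 1}"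
  by (simp add: J_plus_def)

text \<open>This is the Sierpinski space with open point \<open>Num 0\<close>: the least
  neighbourhood of \<open>x\<close> is \<open>{Num 0, x}\<close>.\<close>

lemma nbhd_J_plus:
  "nbhd (spc J_plus) x U \<longleftrightarrow> U \<subseteq> {Num 0, Num 1} \<and> x \<in> U \<and> Num 0 \<in> U"
  by (auto simp: nbhd_def J_plus_def split: if_splits)

lemma interval_for_J_plus: "interval_for times_op J_plus"
proof -
  have cont: "cl_continuous (times_op (spc J_plus) (spc J_plus)) (spc J_plus)
      (\<lambda>p. num_max (pr1 p) (pr2 p))"
  proof (rule cl_continuousI)
    show "(\<lambda>p. num_max (pr1 p) (pr2 p)) \<in> pts (times_op (spc J_plus) (spc J_plus)) \<rightarrow> pts (spc J_plus)"
      by (auto simp: num_max_def elim!: pr_setE)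
    fix p V
    assume "p \<in> pts (times_op (spc J_plus) (spc J_plus))"
      and V: "nbhd (spc J_plus) (num_max (pr1 p) (pr2 p)) V"
    then obtain a b where p: "p = Pr a b" "a \<in> {Num 0, Num 1}" "b \<in> {Num 0, Num 1}"
      by (auto elim!: pr_setE)
    have "nbhd (times_op (spc J_plus) (spc J_plus)) p (pr_set {Num 0, a} {Num 0, b})"
      unfolding p(1) nbhd_times_op using p
      by (intro conjI exI[of _ "{Num 0, a}"] exI[of _ "{Num 0, b}"])
        (auto simp: nbhd_J_plus pr_set_subset_iff)
    moreover have "(\<lambda>p. num_max (pr1 p) (pr2 p)) ` pr_set {Num 0, a} {Num 0, b} \<subseteq> V"
      using V p by (auto simp: nbhd_J_plus num_max_def elim!: pr_setE)
    ultimately show "\<exists>U. nbhd (times_op (spc J_plus) (spc J_plus)) p U \<and>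
        (\<lambda>p. num_max (pr1 p) (pr2 p)) ` U \<subseteq> V" by blast
  qed (simp_all add: closure_space_times_op closure_space_J_plus)
  from interval_for_num_max[OF closure_space_J_plus _ _ _ cont] show ?thesis
    by (simp add: J_plus_def)
qed

lemma closure_space_J_bot: "closure_space (spc J_bot)"
  by (auto simp: closure_space_def J_bot_def)

lemma pts_J_bot [simp]: "pts (spc J_bot) = {Num 0, Num 1}"
  by (simp add: J_bot_def)

lemma nbhd_J_bot: "nbhd (spc J_bot) x U \<longleftrightarrow> U \<subseteq> {Num 0, Num 1} \<and> x \<in> U"
  by (auto simp: nbhd_def J_bot_def)

text \<open>Since \<open>{t}\<close> is a neighbourhood of \<open>t\<close>, the product is the
  disjoint union of two copies of \<open>X\<close>, and the two slices impose nothing on each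
  other.\<close>

lemma cl_continuous_times_J_bot:
  assumes X: "closure_space X" and Y: "closure_space Y"
    and H: "\<And>t. t \<in> {Num 0, Num 1} \<Longrightarrow> cl_continuous X Y (\<lambda>x. H (Pr x t))"
  shows "cl_continuous (times_op X (spc J_bot)) Y H"
proof (rule cl_continuousI[OF closure_space_times_op[OF X closure_space_J_bot] Y])
  show "H \<in> pts (times_op X (spc J_bot)) \<rightarrow> pts Y"
  proof
    fix p assume "p \<in> pts (times_op X (spc J_bot))"
    then obtain x t where "p = Pr x t" "x \<in> pts X" "t \<in> {Num 0, Num 1}"
      unfolding pts_times_op pts_J_bot by (rule pr_setE)
    then show "H p \<in> pts Y" using cl_continuous_pts[OF H] by simp
  qed
  fix p V assume "p \<in> pts (times_op X (spc J_bot))" and V: "nbhd Y (H p) V"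
  then obtain x t where p: "p = Pr x t" "x \<in> pts X" "t \<in> {Num 0, Num 1}"
    unfolding pts_times_op pts_J_bot by (elim pr_setE)
  obtain U where U: "nbhd X x U" "(\<lambda>x. H (Pr x t)) ` U \<subseteq> V"
    using cl_continuous_nbhd[OF X Y H[OF p(3)] p(2)] V p(1) by blast
  have "U \<subseteq> pts X" using U(1) by (simp add: nbhd_def)
  then have "nbhd (times_op X (spc J_bot)) p (pr_set U {t})"
    unfolding p(1) nbhd_times_op using U(1) p(3)
    by (intro conjI exI[of _ U] exI[of _ "{t}"]) (auto simp: nbhd_J_bot pr_set_subset_iff)
  moreover have "H ` pr_set U {t} \<subseteq> V" using U(2) by (auto elim!: pr_setE)
  ultimately show "\<exists>U. nbhd (times_op X (spc J_bot)) p U \<and> H ` U \<subseteq> V" by blast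
qed

lemma cl_continuous_on_J_bot:
  assumes Y: "closure_space Y" and f: "f \<in> {Num 0, Num 1} \<rightarrow> pts Y"
  shows "cl_continuous (spc J_bot) Y f"
proof (rule cl_continuousI[OF closure_space_J_bot Y])
  show "\<exists>U. nbhd (spc J_bot) x U \<and> f ` U \<subseteq> V" if "x \<in> pts (spc J_bot)" "nbhd Y (f x) V" for x V
    using that nbhd_mem[OF Y that(2)] by (intro exI[of _ "{x}"]) (auto simp: nbhd_J_bot)
qed (use f in auto)

lemma interval_for_J_bot: "interval_for times_op J_bot"
proof -
  have "cl_continuous (times_op (spc J_bot) (spc J_bot)) (spc J_bot) (\<lambda>p. num_max (pr1 p) (pr2 p))"
    by (intro cl_continuous_times_J_bot cl_continuous_on_J_bot closure_space_J_bot)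
      (auto simp: num_max_def)
  from interval_for_num_max[OF closure_space_J_bot _ _ _ this] show ?thesis by (simp add: J_bot_def)
qed

section \<open>The unit interval and the one-point interval\<close>

lemma pts_I_tau [simp]: "pts (spc I_tau) = Num ` {0..1}"
  by (simp add: I_tau_def)

text \<open>The filter \<open>nhds t\<close> does not remove \<open>t\<close>, so meeting a set
  frequently is lying in its closure. In this form additivity is \<open>frequently_disj_iff\<close>,
  and negation turns neighbourhoods into \<open>eventually\<close> statements.\<close>

lemma clo_I_tau:
  "clo (spc I_tau) A = Num ` {t \<in> {0..1}. \<exists>\<^sub>F s in nhds t. s \<in> {0..1} \<and> Num s \<in> A}"
proof -
  have "t \<in> closure S \<longleftrightarrow> (\<exists>\<^sub>F s in nhds t. s \<in> S)" for t :: real and S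
    by (auto simp: frequently_def eventually_nhds_metric closure_approachable)
  then have "top_of_set {0..1::real} closure_of (Num -` A) =
      {t \<in> {0..1}. \<exists>\<^sub>F s in nhds t. s \<in> {0..1} \<and> Num s \<in> A}"
    by (auto simp: closure_of_subtopology)
  then show ?thesis by (simp add: I_tau_def)
qed

lemma closure_space_I_tau: "closure_space (spc I_tau :: 'a space)"
proof -
  let ?I = "spc I_tau :: 'a space"
  have sub: "A \<subseteq> clo ?I A" if A: "A \<subseteq> Num ` {0..1}" for A
  proof
    fix x assume x: "x \<in> A"
    then obtain t where t: "x = Num t" "t \<in> {0..1}" using A by blast
    have "\<exists>\<^sub>F s in nhds t. s \<in> {0..1} \<and> Num s \<in> A"
      using x t eventually_nhds_x_imp_x by (fastforce simp: frequently_def)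
    then show "x \<in> clo ?I A" using t by (auto simp: clo_I_tau)
  qed
  have un: "clo ?I (A \<union> B) = clo ?I A \<union> clo ?I B" for A B
    by (auto simp: clo_I_tau conj_disj_distribL frequently_disj_iff)
  show ?thesis
    unfolding closure_space_def pts_I_tau
    by (intro conjI allI impI sub un) (auto simp: clo_I_tau)
qed

lemma nbhd_I_tau:
  assumes "t \<in> {0..1}"
  shows "nbhd (spc I_tau) (Num t) U \<longleftrightarrow>
    U \<subseteq> Num ` {0..1} \<and> (\<forall>\<^sub>F s in nhds t. s \<in> {0..1} \<longrightarrow> Num s \<in> U)"
proof -
  have eq: "(s \<in> {0..1} \<and> Num s \<in> Num ` {0..1} - U) \<longleftrightarrow> \<not> (s \<in> {0..1} \<longrightarrow> Num s \<in> U)" for s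
    by auto
  have "(\<exists>\<^sub>F s in nhds t. s \<in> {0..1} \<and> Num s \<in> Num ` {0..1} - U) \<longleftrightarrow>
      \<not> (\<forall>\<^sub>F s in nhds t. s \<in> {0..1} \<longrightarrow> Num s \<in> U)"
    by (simp only: frequently_def eq not_not)
  then have "Num t \<in> clo (spc I_tau) (Num ` {0..1} - U) \<longleftrightarrow>
      \<not> (\<forall>\<^sub>F s in nhds t. s \<in> {0..1} \<longrightarrow> Num s \<in> U)"
    using assms unfolding clo_I_tau by auto
  then show ?thesis using assms by (simp add: nbhd_def)
qed

lemma interval_for_I_tau: "interval_for times_op (I_tau :: 'a interval_data)"
proof -
  have cont: "cl_continuous (times_op (spc I_tau) (spc I_tau)) (spc (I_tau :: 'a interval_data))
      (\<lambda>p. num_max (pr1 p) (pr2 p))"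
  proof (rule cl_continuousI)
    show "(\<lambda>p. num_max (pr1 p) (pr2 p)) \<in> pts (times_op (spc I_tau) (spc I_tau)) \<rightarrow> pts (spc I_tau)"
      by (auto simp: num_max_def max_def elim!: pr_setE)
    fix p and V :: "'a pt set"
    assume "p \<in> pts (times_op (spc I_tau) (spc I_tau))"
      and V: "nbhd (spc I_tau) (num_max (pr1 p) (pr2 p)) V"
    then obtain a b where p: "p = Pr (Num a) (Num b)" and a: "a \<in> {0..1}" and b: "b \<in> {0..1}"
      by (auto elim!: pr_setE)
    have "max a b \<in> {0..1}" using a b by auto
    then have "\<forall>\<^sub>F r in nhds (max a b). r \<in> {0..1} \<longrightarrow> Num r \<in> V"
      using V p by (simp add: num_max_def nbhd_I_tau)
    then obtain e where e: "e > 0" "\<And>r. \<bar>r - max a b\<bar> < e \<Longrightarrow> r \<in> {0..1} \<Longrightarrow> Num r \<in> V"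
      unfolding eventually_nhds_metric dist_real_def by blast
    \<comment> \<open>The same radius \<open>e\<close> serves both factors: \<open>max\<close> moves
      by no more than the larger of the two displacements.\<close>
    define W :: "real \<Rightarrow> 'a pt set" where "W c = Num ` {s \<in> {0..1}. \<bar>s - c\<bar> < e}" for c
    have W: "nbhd (spc I_tau) (Num c) (W c)" if "c \<in> {0..1}" for c
      using that e(1) unfolding nbhd_I_tau[OF that] W_def eventually_nhds_metric dist_real_def
      by auto
    have "nbhd (times_op (spc I_tau) (spc I_tau)) p (pr_set (W a) (W b))"
      unfolding p(1) nbhd_times_op using W[OF a] W[OF b]
      by (intro conjI exI[of _ "W a"] exI[of _ "W b"]) (auto simp: W_def pr_set_subset_iff)
    moreover have "(\<lambda>p. num_max (pr1 p) (pr2 p)) ` pr_set (W a) (W b) \<subseteq> V"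
      by (auto simp: W_def num_max_def elim!: pr_setE intro!: e(2))
    ultimately show "\<exists>U. nbhd (times_op (spc I_tau) (spc I_tau)) p U \<and>
        (\<lambda>p. num_max (pr1 p) (pr2 p)) ` U \<subseteq> V" by blast
  qed (simp_all add: closure_space_times_op closure_space_I_tau)
  have "interval_for times_op \<lparr>spc = spc (I_tau :: 'a interval_data), pt0 = Num 0, pt1 = Num 1, join = num_max\<rparr>"
    by (rule interval_for_num_max[OF closure_space_I_tau _ _ _ cont]) auto
  then show ?thesis by (simp add: I_tau_def)
qed

lemma interval_for_J_pt: "interval_for times_op (J_pt :: 'a interval_data)"
proof -
  let ?P = "one_point :: 'a space"
  have "cl_continuous (times_op ?P ?P) ?P (\<lambda>p. Num 0)"
    by (intro cl_continuous_const closure_space_times_op closure_space_one_point)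
      (simp add: pts_one_point)
  moreover have "cl_continuous (times_op ?P ?P) ?P
        (\<lambda>p. num_max (pr1 p) (pr2 p)) \<longleftrightarrow>
      cl_continuous (times_op ?P ?P) ?P (\<lambda>p. Num 0)"
    by (rule cl_continuous_cong[OF closure_space_times_op[OF closure_space_one_point closure_space_one_point]])
      (auto simp: pts_one_point num_max_def elim!: pr_setE)
  ultimately show ?thesis
    by (simp add: interval_for_def J_pt_def closure_space_one_point pts_one_point)
      (simp add: num_max_def)
qed

lemma interval_pair_eight_pairs: "p \<in> eight_pairs \<Longrightarrow> interval_pair p"
  by (auto simp: eight_pairs_def interval_pair_def product_operation_times_op
      product_operation_box_op interval_for_box_op interval_for_J_pt interval_for_J_top
      interval_for_J_plus interval_for_I_tau interval_for_J_bot)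

section \<open>Homotopies\<close>

lemma le_atI:
  assumes "\<And>f g. elem_homotopic p X Y f g \<Longrightarrow> elem_homotopic q X Y f g"
  shows "le_at X Y p q"
  unfolding le_at_def homotopic_by_def
proof (intro ballI impI)
  fix f g assume "equivclp (elem_homotopic p X Y) f g"
  then show "equivclp (elem_homotopic q X Y) f g"
    by (induction rule: equivclp_induct) (auto intro: equivclp_into_equivclp assms)
qed

text \<open>The device for proving maps inequivalent: a zigzag can leave or reach \<open>h\<close>
  only through an elementary step that does so.\<close>

lemma homotopic_by_eqI:
  assumes "\<And>f g. elem_homotopic p X Y f g \<Longrightarrow> f = h \<longleftrightarrow> g = h"
    and "homotopic_by p X Y f g"
  shows "f = h \<longleftrightarrow> g = h"
  using assms(2) unfolding homotopic_by_def
  by (induction rule: equivclp_induct) (use assms(1) in blast)+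

text \<open>Reparametrise the time factor by \<open>\<phi>\<close>, which is legitimate by
  functoriality of \<open>T\<close>. This explains the reversal: a map from \<open>J'\<close> to
  \<open>J\<close> makes \<open>J'\<close> the coarser interval.\<close>

lemma elem_homotopic_change_interval:
  assumes T: "product_operation T" and X: "closure_space X"
    and J: "closure_space (spc J)" and J': "closure_space (spc J')"
    and \<phi>: "cl_continuous (spc J') (spc J) \<phi>" "\<phi> (pt0 J') = pt0 J" "\<phi> (pt1 J') = pt1 J"
    and h: "elem_homotopic (J, T) X Y f g"
  shows "elem_homotopic (J', T) X Y f g"
proof -
  obtain H where H: "cl_continuous (T X (spc J)) Y H"
    "\<forall>x\<in>pts X. H (Pr x (pt0 J)) = f x \<and> H (Pr x (pt1 J)) = g x"
    using h by (auto simp: elem_homotopic_def)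
  have "cl_continuous (T X (spc J')) (T X (spc J)) (pr_map (\<lambda>x. x) \<phi>)"
    by (rule product_operationD(2)[OF T X J' X J cl_continuous_id \<phi>(1)])
  from cl_continuous_compose[OF this H(1)]
  show ?thesis using H(2) h \<phi>(2,3)
    unfolding elem_homotopic_def by (auto intro!: exI simp: pr_map_def)
qed

lemma elem_homotopic_times_box:
  assumes X: "closure_space X" and J: "closure_space (spc J)"
    and h: "elem_homotopic (J, times_op) X Y f g"
  shows "elem_homotopic (J, box_op) X Y f g"
  using h cl_continuous_compose[OF cl_continuous_box_times[OF X J]]
  unfolding elem_homotopic_def by auto

lemma elem_homotopic_J_bot:
  assumes X: "closure_space X" and Y: "closure_space Y"
    and f: "f \<in> cl_maps X Y" and g: "g \<in> cl_maps X Y"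
  shows "elem_homotopic (J_bot, times_op) X Y f g"
proof -
  have "cl_continuous (times_op X (spc J_bot)) Y (\<lambda>p. if pr2 p = Num 0 then f (pr1 p) else g (pr1 p))"
    using f g by (intro cl_continuous_times_J_bot[OF X Y]) (auto simp: cl_maps_def)
  then show ?thesis
    using f g unfolding elem_homotopic_def by (auto intro!: exI simp: J_bot_def)
qed

lemma elem_homotopic_J_pt_eq:
  assumes "elem_homotopic (J_pt, T) X Y f g"
  shows "f = g"
proof -
  have "f \<in> extensional (pts X)" "g \<in> extensional (pts X)" "\<forall>x\<in>pts X. f x = g x"
    using assms by (auto simp: elem_homotopic_def cl_maps_def J_pt_def)
  then show ?thesis by (intro extensionalityI) auto
qed

lemma homotopic_by_J_pt_iff: "homotopic_by (J_pt, T) X Y f g \<longleftrightarrow> f = g"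
proof
  assume "homotopic_by (J_pt, T) X Y f g"
  from homotopic_by_eqI[OF _ this, of f] show "f = g" using elem_homotopic_J_pt_eq by blast
next
  assume "f = g"
  then show "homotopic_by (J_pt, T) X Y f g" by (simp add: homotopic_by_def)
qed

lemma J_pt_le_at: "le_at X Y (J_pt, T) q"
  by (simp add: le_at_def homotopic_by_J_pt_iff) (simp add: homotopic_by_def)

lemma le_at_diagram_edges:
  assumes X: "closure_space X" and Y: "closure_space Y" and e: "(p, q) \<in> diagram_edges"
  shows "le_at X Y p q"
proof -
  note times = product_operation_times_op and box = product_operation_box_op
  have bot: "le_at X Y p (J_bot, times_op)" for p
    using elem_homotopic_J_bot[OF X Y] by (intro le_atI) (simp add: elem_homotopic_def)
  have \<phi>1: "cl_continuous (spc J_plus) (spc J_top) (\<lambda>x. x)"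
    by (intro cl_continuous_into_J_top closure_space_J_plus) simp
  have top_plus: "le_at X Y (J_top, T) (J_plus, T)" if "product_operation T" for T :: "'a prod_op"
    using elem_homotopic_change_interval[OF that X closure_space_J_top closure_space_J_plus \<phi>1]
    by (intro le_atI) (simp add: J_top_def J_plus_def)
  \<comment> \<open>The open point \<open>Num 0\<close> of \<open>J_plus\<close> needs a relatively
    open preimage, here [0,1). Sending all of (0,1] to \<open>Num 1\<close> instead would leave the
    preimage {0}, which is not open.\<close>
  define \<phi> :: "'a pt \<Rightarrow> 'a pt" where "\<phi> p = (if p = Num 1 then Num 1 else Num 0)" for p
  have \<phi>2: "cl_continuous (spc I_tau) (spc J_plus) \<phi>"
  proof (rule cl_continuousI[OF closure_space_I_tau closure_space_J_plus])
    fix x V assume "x \<in> pts (spc I_tau)" and V: "nbhd (spc J_plus) (\<phi> x) V"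
    then obtain t where t: "x = Num t" "t \<in> {0..1}" by auto
    show "\<exists>U. nbhd (spc I_tau) x U \<and> \<phi> ` U \<subseteq> V"
    proof (cases "t = 1")
      case True
      then have "V = {Num 0, Num 1}" using V t by (auto simp: nbhd_J_plus \<phi>_def)
      then show ?thesis using t
        by (intro exI[of _ "Num ` {0..1}"]) (auto simp: nbhd_I_tau \<phi>_def)
    next
      case False
      have "Num 0 \<in> V" using V by (simp add: nbhd_J_plus)
      moreover have "\<forall>\<^sub>F s in nhds t. s \<noteq> 1" using False by (rule t1_space_nhds)
      then have "\<forall>\<^sub>F s in nhds t. s \<in> {0..1} \<longrightarrow> Num s \<in> Num ` ({0..1} - {1})"
        by (rule eventually_mono) auto
      ultimately show ?thesis unfolding t(1) nbhd_I_tau[OF t(2)]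
        by (intro exI[of _ "Num ` ({0..1} - {1})"]) (auto simp: \<phi>_def)
    qed
  qed (auto simp: \<phi>_def)
  have plus_tau: "le_at X Y (J_plus, T) (I_tau, T)" if "product_operation T" for T
    using elem_homotopic_change_interval[OF that X closure_space_J_plus closure_space_I_tau \<phi>2]
    by (intro le_atI) (simp add: I_tau_def J_plus_def \<phi>_def)
  have times_box: "le_at X Y (J, times_op) (J, box_op)" if "closure_space (spc J)" for J
    by (intro le_atI elem_homotopic_times_box[OF X that])
  show ?thesis
    using e unfolding diagram_edges_def
    by (auto intro: J_pt_le_at bot top_plus[OF times] top_plus[OF box] plus_tau[OF times] plus_tau[OF box]
        times_box closure_space_J_top closure_space_J_plus closure_space_I_tau)
qed

section \<open>The shape of the diagram\<close>

text \<open>Pure order theory, kept abstract so that no space is unfolded during the case check. The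
  letters follow the order in which \<open>eight_pairs\<close> lists its elements.\<close>

lemma eight_element_hasse_diagram:
  fixes le :: "'b \<Rightarrow> 'b \<Rightarrow> bool"
  assumes refl: "\<And>x. le x x" and trans: "\<And>x y z. le x y \<Longrightarrow> le y z \<Longrightarrow> le x z"
    and edges:
      "le a b" "le b c" "le b d" "le c e" "le c f" "le d f" "le e g" "le f g" "le g h"
    and non: "\<not> le b a" "\<not> le c d" "\<not> le d e" "\<not> le e f" "\<not> le h g"
  defines "E \<equiv> {a, b, c, d, e, f, g, h}"
    and "D \<equiv> {(a, b), (b, c), (b, d), (c, e), (c, f), (d, f), (e, g), (f, g), (g, h)}"
  shows "card E = 8 \<and> partial_order_on E {(p, q). p \<in> E \<and> q \<in> E \<and> le p q} \<and>
    hasse_edges {(p, q). p \<in> E \<and> q \<in> E \<and> le p q} = D"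
proof -
  note fh = trans[OF edges(8) edges(9)]
  note eh = trans[OF edges(7) edges(9)]
  note dg = trans[OF edges(6) edges(8)]
  note dh = trans[OF edges(6) fh]
  note cg = trans[OF edges(4) edges(7)]
  note ch = trans[OF edges(4) eh]
  note be = trans[OF edges(2) edges(4)]
  note bf = trans[OF edges(2) edges(5)]
  note bg = trans[OF edges(2) cg]
  note bh = trans[OF edges(2) ch]
  note ac = trans[OF edges(1) edges(2)]
  note ad = trans[OF edges(1) edges(3)]
  note ae = trans[OF edges(1) be]
  note af = trans[OF edges(1) bf]
  note ag = trans[OF edges(1) bg]
  note ah = trans[OF edges(1) bh]
  note pos = refl edges fh eh dg dh cg ch be bf bg bh ac ad ae af ag ah
  \<comment> \<open>A non-relation spreads: if \<open>p\<close> is above \<open>b\<close> and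
    \<open>q\<close> below \<open>a\<close>, then \<open>le p q\<close> would give
    \<open>le b a\<close>. The four other given non-relations spread in the same way.\<close>
  have n1: "\<not> le p q" if "le b p" "le q a" for p q
    using trans[OF trans[OF that(1) _] that(2)] non(1) by blast
  have neg1:
    "\<not> le b a" "\<not> le c a" "\<not> le d a" "\<not> le e a" "\<not> le f a"
    "\<not> le g a" "\<not> le h a"
    by (rule n1; simp add: pos)+
  have n2: "\<not> le p q" if "le c p" "le q d" for p q
    using trans[OF trans[OF that(1) _] that(2)] non(2) by blast
  have neg2:
    "\<not> le c b" "\<not> le c d" "\<not> le e b" "\<not> le e d" "\<not> le f b"
    "\<not> le f d" "\<not> le g b" "\<not> le g d" "\<not> le h b" "\<not> le h d"
    by (rule n2; simp add: pos)+
  have n3: "\<not> le p q" if "le d p" "le q e" for p q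
    using trans[OF trans[OF that(1) _] that(2)] non(3) by blast
  have neg3:
    "\<not> le d b" "\<not> le d c" "\<not> le d e" "\<not> le f c" "\<not> le f e"
    "\<not> le g c" "\<not> le g e" "\<not> le h c" "\<not> le h e"
    by (rule n3; simp add: pos)+
  have n4: "\<not> le p q" if "le e p" "le q f" for p q
    using trans[OF trans[OF that(1) _] that(2)] non(4) by blast
  have neg4:
    "\<not> le e c" "\<not> le e f" "\<not> le g f" "\<not> le h f"
    by (rule n4; simp add: pos)+
  have n5: "\<not> le p q" if "le h p" "le q g" for p q
    using trans[OF trans[OF that(1) _] that(2)] non(5) by blast
  have neg5:
    "\<not> le h g"
    by (rule n5; simp add: pos)+
  note neg = neg1 neg2 neg3 neg4 neg5
  \<comment> \<open>By reflexivity, a non-relation in either direction makes two letters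
    distinct.\<close>
  have ne: "x \<noteq> y" "y \<noteq> x" if "\<not> le x y" for x y
    using that refl by auto
  note dist = neg[THEN ne(1)] neg[THEN ne(2)]
  have "card E = 8" by (simp add: E_def dist)
  moreover have "\<forall>p\<in>E. \<forall>q\<in>E. le p q \<longrightarrow> le q p \<longrightarrow> p = q"
    unfolding E_def by (simp add: pos neg)
  then have "antisym {(p, q). p \<in> E \<and> q \<in> E \<and> le p q}"
    by (auto simp: antisym_def)
  then have "partial_order_on E {(p, q). p \<in> E \<and> q \<in> E \<and> le p q}"
    unfolding partial_order_on_def preorder_on_def
    by (auto simp: refl_on_def refl intro!: transI intro: trans)
  moreover have "hasse_edges {(p, q). p \<in> E \<and> q \<in> E \<and> le p q} = D"
  proof -
    have D: "le p q \<and> p \<noteq> q \<and> \<not> (\<exists>z\<in>E. z \<noteq> p \<and> z \<noteq> q \<and> le p z \<and> le z q) \<longleftrightarrow> (p, q) \<in> D"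
      if "p \<in> E" "q \<in> E" for p q
    proof -
      \<comment> \<open>The 33 relations in \<open>pos\<close> (eight of them by reflexivity) and
        the 31 in \<open>neg\<close> decide all 64 ordered pairs, so the finite quantifiers can be
        evaluated.\<close>
      have "\<forall>p\<in>E. \<forall>q\<in>E.
          le p q \<and> p \<noteq> q \<and> \<not> (\<exists>z\<in>E. z \<noteq> p \<and> z \<noteq> q \<and> le p z \<and> le z q) \<longleftrightarrow> (p, q) \<in> D"
        unfolding E_def D_def by (simp add: pos neg dist)
      then show ?thesis using that by blast
    qed
    have "D \<subseteq> E \<times> E" by (simp add: D_def E_def)
    then show ?thesis unfolding hasse_edges_def using D by fastforce
  qed
  ultimately show ?thesis by blast
qed

section \<open>Non-relations\<close>

lemma interval_points [simp]:
  "pt0 J_top = Num 0" "pt1 J_top = Num 1" "pt0 J_plus = Num 0" "pt1 J_plus = Num 1"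
  "pt0 J_bot = Num 0" "pt1 J_bot = Num 1" "pt0 I_tau = Num 0" "pt1 I_tau = Num 1"
  "pt0 J_pt = Num 0" "pt1 J_pt = Num 0"
  by (simp_all add: J_top_def J_plus_def J_bot_def I_tau_def J_pt_def)

definition pt_map :: "'a pt \<Rightarrow> 'a pt \<Rightarrow> 'a pt" where
  "pt_map y = restrict (\<lambda>_. y) (pts one_point)"

lemma pt_map_in_cl_maps:
  fixes Y :: "'a space"
  assumes "closure_space Y" "y \<in> pts Y"
  shows "pt_map y \<in> cl_maps one_point Y"
proof -
  have "cl_continuous one_point Y (pt_map y) \<longleftrightarrow> cl_continuous one_point Y (\<lambda>_ :: 'a pt. y)"
    by (rule cl_continuous_cong[OF closure_space_one_point]) (simp add: pt_map_def)
  then show ?thesis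
    using cl_continuous_const[OF closure_space_one_point assms] by (simp add: cl_maps_def pt_map_def)
qed

text \<open>The unitor \<open>pr2\<close> turns a path into a homotopy, whatever the product
  operation.\<close>

lemma elem_homotopic_one_pointI:
  fixes Y :: "'a space"
  assumes T: "product_operation T" and J: "interval_for T J" and Y: "closure_space Y"
    and \<gamma>: "cl_continuous (spc J) Y \<gamma>"
  shows "elem_homotopic (J, T) one_point Y (pt_map (\<gamma> (pt0 J))) (pt_map (\<gamma> (pt1 J)))"
proof -
  have J': "closure_space (spc J)" "pt0 J \<in> pts (spc J)" "pt1 J \<in> pts (spc J)"
    using J by (auto simp: interval_for_def)
  have "cl_continuous (T one_point (spc J)) (spc J) pr2"
    using product_operationD(3)[OF T J'(1) J'(1)] by (simp add: cl_homeo_def)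
  from cl_continuous_compose[OF this \<gamma>]
  show ?thesis
    using pt_map_in_cl_maps[OF Y] cl_continuous_pts[OF \<gamma>] J'
    unfolding elem_homotopic_def by (auto intro!: exI simp: pt_map_def)
qed

lemma elem_homotopic_one_pointE:
  assumes T: "product_operation T" and J: "interval_for T J"
    and h: "elem_homotopic (J, T) one_point Y f g"
  obtains \<gamma> where "cl_continuous (spc J) Y \<gamma>"
    and "\<gamma> (pt0 J) = f (Num 0)" "\<gamma> (pt1 J) = g (Num 0)"
proof -
  have J': "closure_space (spc J)" "pt0 J \<in> pts (spc J)" "pt1 J \<in> pts (spc J)"
    using J by (auto simp: interval_for_def)
  obtain H where H: "cl_continuous (T one_point (spc J)) Y H"
    "H (Pr (Num 0) (pt0 J)) = f (Num 0)" "H (Pr (Num 0) (pt1 J)) = g (Num 0)"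
    using h by (auto simp: elem_homotopic_def pts_one_point)
  have "cl_homeo (T one_point (spc J)) (spc J) pr2"
    and P: "pts (T one_point (spc J)) = pr_set (pts one_point) (pts (spc J))"
    using product_operationD(1,3)[OF T] J'(1) closure_space_one_point by blast+
  then obtain k where k: "cl_continuous (spc J) (T one_point (spc J)) k"
    "\<forall>y\<in>pts (spc J). pr2 (k y) = y" unfolding cl_homeo_def by blast
  \<comment> \<open>The inverse of the unitor is known only abstractly. Its second coordinate is
    \<open>y\<close> and its first can only be \<open>Num 0\<close>, which is where the end values
    of \<open>H\<close> are given.\<close>
  have "k y = Pr (Num 0) y" if "y \<in> pts (spc J)" for y
    using cl_continuous_pts[OF k(1) that] k(2) that by (auto simp: P pts_one_point elim!: pr_setE)
  then show thesis
    using that[OF cl_continuous_compose[OF k(1) H(1)]] H J' by simp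
qed

text \<open>If \<open>J'\<close> paths in \<open>Y\<close> cannot have distinct ends, elementary
  \<open>J'\<close> homotopies out of the point are equalities, and so are zigzags of them; but
  \<open>\<gamma>\<close> joins two distinct points.\<close>

lemma not_le_uniform_by_paths:
  fixes Y :: "'a space" and J J' :: "'a interval_data"
  assumes p: "interval_pair (J, T)" and q: "interval_pair (J', T')" and Y: "closure_space Y"
    and \<gamma>: "cl_continuous (spc J) Y \<gamma>" "\<gamma> (pt0 J) \<noteq> \<gamma> (pt1 J)"
    and const: "\<And>\<delta>. cl_continuous (spc J') Y \<delta> \<Longrightarrow> \<delta> (pt0 J') = \<delta> (pt1 J')"
  shows "\<not> le_uniform (J, T) (J', T')"
proof
  let ?f = "pt_map (\<gamma> (pt0 J))" and ?g = "pt_map (\<gamma> (pt1 J))"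
  have J: "product_operation T" "interval_for T J" and J': "product_operation T'" "interval_for T' J'"
    using p q by (auto simp: interval_pair_def)
  have h: "elem_homotopic (J, T) one_point Y ?f ?g"
    by (rule elem_homotopic_one_pointI[OF J Y \<gamma>(1)])
  have "homotopic_by (J, T) one_point Y ?f ?g"
    unfolding homotopic_by_def by (rule r_into_equivclp) (rule h)
  moreover assume "le_uniform (J, T) (J', T')"
  moreover have "?f \<in> cl_maps one_point Y" "?g \<in> cl_maps one_point Y"
    using h by (simp_all add: elem_homotopic_def)
  ultimately have "homotopic_by (J', T') one_point Y ?f ?g"
    using closure_space_one_point Y unfolding le_uniform_def le_at_def by blast
  moreover have "u = v" if uv: "elem_homotopic (J', T') one_point Y u v" for u v
  proof (rule extensionalityI)
    show "u \<in> extensional (pts one_point)" "v \<in> extensional (pts one_point)"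
      using uv by (auto simp: elem_homotopic_def cl_maps_def)
    show "u x = v x" if "x \<in> pts one_point" for x
      using that elem_homotopic_one_pointE[OF J' uv] const by (metis pts_one_point singletonD)
  qed
  ultimately have "?f = ?g" using homotopic_by_eqI[of _ one_point Y ?f ?f ?g] by metis
  then have "?f (Num 0) = ?g (Num 0)" by simp
  then show False using \<gamma>(2) by (simp add: pt_map_def pts_one_point)
qed

text \<open>Connectedness of the unit interval, in the form in which rigidity statements use
  it.\<close>

lemma locally_constant_Icc:
  fixes S :: "real \<Rightarrow> bool"
  assumes "\<And>t. t \<in> {0..1} \<Longrightarrow> \<forall>\<^sub>F s in nhds t. s \<in> {0..1} \<longrightarrow> S s = S t"
  shows "S 0 = S 1"
proof -
  \<comment> \<open>The membership guards are there because the local hypothesis of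
    \<open>Bolzano\<close> also ranges over intervals that stick out of [0,1].\<close>
  define P where "P a b \<longleftrightarrow> (a \<in> {0..1} \<longrightarrow> b \<in> {0..1} \<longrightarrow> S a = S b)" for a b
  have "(0::real) \<le> 1" by simp
  then have "P 0 1"
  proof (induction rule: Bolzano)
    case (trans a b c)
    then show ?case by (auto simp: P_def)
  next
    case (local t)
    then obtain d where d: "d > 0" "\<And>s. \<bar>s - t\<bar> < d \<Longrightarrow> s \<in> {0..1} \<Longrightarrow> S s = S t"
      using assms[of t] unfolding eventually_nhds_metric dist_real_def by auto
    have "P a b" if "a \<le> t \<and> t \<le> b \<and> b - a < d" for a b
      using d(2)[of a] d(2)[of b] that by (auto simp: P_def)
    with d(1) show ?case by blast
  qed
  then show ?thesis by (simp add: P_def)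
qed

text \<open>Here and in the next three lemmas the first interval is its own target space: its
  identity is the universal path.\<close>

lemma J_top_times_not_le_J_pt_times: "\<not> le_uniform (J_top, times_op) (J_pt, times_op)"
proof (rule not_le_uniform_by_paths)
  show "cl_continuous (spc J_top) (spc J_top) (\<lambda>x. x)" by (rule cl_continuous_id)
qed (simp_all add: interval_pair_eight_pairs eight_pairs_def closure_space_J_top)

text \<open>The points of \<open>J_top\<close> lie in each other's closure, which two distinct
  points of \<open>J_plus\<close> never do.\<close>

lemma J_plus_times_not_le_J_top_box: "\<not> le_uniform (J_plus, times_op) (J_top, box_op)"
proof (rule not_le_uniform_by_paths)
  show "cl_continuous (spc J_plus) (spc J_plus) (\<lambda>x. x)" by (rule cl_continuous_id)
  fix \<delta> :: "'a pt \<Rightarrow> 'a pt" assume \<delta>: "cl_continuous (spc J_top) (spc J_plus) \<delta>"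
  have "\<delta> a \<in> clo (spc J_plus) {\<delta> b}" if "a \<in> {Num 0, Num 1}" "b \<in> {Num 0, Num 1}" for a b
  proof -
    have "\<delta> ` clo (spc J_top) {b} \<subseteq> clo (spc J_plus) (\<delta> ` {b})"
      using that(2) by (intro cl_continuous_clo[OF \<delta>]) simp
    then show ?thesis using that by (auto simp: J_top_def)
  qed
  from this[of "Num 0" "Num 1"] this[of "Num 1" "Num 0"]
  show "\<delta> (pt0 J_top) = \<delta> (pt1 J_top)" by (auto simp: J_plus_def split: if_splits)
qed (simp_all add: interval_pair_eight_pairs eight_pairs_def closure_space_J_plus)

text \<open>In \<open>J_plus\<close> the point \<open>Num 1\<close> is in the closure of
  \<open>Num 0\<close>, whereas singletons of \<open>I_tau\<close> are closed.\<close>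

lemma I_tau_times_not_le_J_plus_box: "\<not> le_uniform (I_tau, times_op) (J_plus, box_op)"
proof (rule not_le_uniform_by_paths)
  show "cl_continuous (spc I_tau) (spc I_tau) (\<lambda>x. x)" by (rule cl_continuous_id)
  fix \<delta> :: "'a pt \<Rightarrow> 'a pt" assume \<delta>: "cl_continuous (spc J_plus) (spc I_tau) \<delta>"
  have "\<delta> ` clo (spc J_plus) {Num 0} \<subseteq> clo (spc I_tau) (\<delta> ` {Num 0})"
    by (intro cl_continuous_clo[OF \<delta>]) simp
  then have 1: "\<delta> (Num 1) \<in> clo (spc I_tau) {\<delta> (Num 0)}" by (auto simp: J_plus_def)
  then obtain s where s: "\<delta> (Num 1) = Num s"
      "\<exists>\<^sub>F r in nhds s. r \<in> {0..1} \<and> Num r \<in> {\<delta> (Num 0)}"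
    unfolding clo_I_tau by blast
  have "\<delta> (Num 0) = Num s"
  proof (rule ccontr)
    assume ne: "\<delta> (Num 0) \<noteq> Num s"
    obtain r where r: "\<delta> (Num 0) = Num r" using cl_continuous_pts[OF \<delta>, of "Num 0"] by auto
    have "\<forall>\<^sub>F u in nhds s. u \<noteq> r" using ne r by (intro t1_space_nhds) auto
    then have "\<forall>\<^sub>F u in nhds s. \<not> (u \<in> {0..1} \<and> Num u \<in> {\<delta> (Num 0)})"
      by (rule eventually_mono) (simp add: r)
    then show False using s(2) by (simp add: frequently_def)
  qed
  then show "\<delta> (pt0 J_plus) = \<delta> (pt1 J_plus)" using s(1) by simp
qed (simp_all add: interval_pair_eight_pairs eight_pairs_def closure_space_I_tau)

lemma J_bot_times_not_le_I_tau_box: "\<not> le_uniform (J_bot, times_op) (I_tau, box_op)"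
proof (rule not_le_uniform_by_paths)
  show "cl_continuous (spc J_bot) (spc J_bot) (\<lambda>x. x)" by (rule cl_continuous_id)
  fix \<delta> :: "'a pt \<Rightarrow> 'a pt" assume \<delta>: "cl_continuous (spc I_tau) (spc J_bot) \<delta>"
  \<comment> \<open>The trivially true left side is the time 0 value of the predicate "equal to the
    starting point", which is locally constant because the target is discrete.\<close>
  have "(\<delta> (Num 0) = \<delta> (Num 0)) = (\<delta> (Num 1) = \<delta> (Num 0))"
  proof (rule locally_constant_Icc)
    fix t :: real assume t: "t \<in> {0..1}"
    then have nt: "Num t \<in> pts (spc I_tau)" by simp
    then have nb: "nbhd (spc J_bot) (\<delta> (Num t)) {\<delta> (Num t)}"
      using cl_continuous_pts[OF \<delta> nt] by (simp add: nbhd_J_bot)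
    obtain U where U: "nbhd (spc I_tau) (Num t) U" "\<delta> ` U \<subseteq> {\<delta> (Num t)}"
      by (rule cl_continuous_nbhd[OF closure_space_I_tau closure_space_J_bot \<delta> nt nb])
    have "\<forall>\<^sub>F s in nhds t. s \<in> {0..1} \<longrightarrow> Num s \<in> U" using U(1) nbhd_I_tau[OF t] by blast
    then show "\<forall>\<^sub>F s in nhds t. s \<in> {0..1} \<longrightarrow> (\<delta> (Num s) = \<delta> (Num 0)) = (\<delta> (Num t) = \<delta> (Num 0))"
      by (rule eventually_mono) (use U(2) in auto)
  qed
  then show "\<delta> (pt0 I_tau) = \<delta> (pt1 I_tau)" by simp
qed (simp_all add: interval_pair_eight_pairs eight_pairs_def closure_space_J_bot)

text \<open>The box product of two indiscrete two-point spaces is a 4-cycle: every vertex is near all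
  vertices but the opposite one.\<close>

definition square :: "'a space" where
  "square = box_op (spc J_top) (spc J_top)"

text \<open>Applied to one coordinate it gives a reflection of the square;
  \<open>pr_map flip flip\<close> gives the opposite vertex.\<close>

definition flip :: "'a pt \<Rightarrow> 'a pt" where
  "flip p = Num (1 - num_val p)"

lemma closure_space_square: "closure_space square"
  by (simp add: square_def closure_space_box_op closure_space_J_top)

lemma pts_square: "pts square = pr_set {Num 0, Num 1} {Num 0, Num 1}"
  by (simp add: square_def)

text \<open>A point of \<open>J_top\<close> has the whole space as its only neighbourhood, so the
  only basic cross at \<open>x\<close> has two full arms and misses just the opposite vertex. This
  one is least by \<open>square_minimal_nbhd\<close>.\<close>

lemma nbhd_square:
  assumes "x \<in> pts square"
  shows "nbhd square x (pts square - {pr_map flip flip x})"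
proof -
  obtain a b where x: "x = Pr a b" "a \<in> {Num 0, Num 1}" "b \<in> {Num 0, Num 1}"
    using assms unfolding pts_square by (rule pr_setE)
  have "nbhd (spc J_top) u (pts (spc J_top))" if "u \<in> {Num 0, Num 1}" for u :: "'a pt"
    using that by (intro nbhd_pts closure_space_J_top) simp
  then have "nbhd (spc J_top) a {Num 0, Num 1}" "nbhd (spc J_top) b {Num 0, Num 1}"
    using x(2,3) by simp_all
  then show ?thesis
    unfolding x(1) square_def nbhd_box_op using x(2,3)
    by (intro conjI exI[of _ "{Num 0, Num 1}"]) (auto simp: pr_map_def flip_def pr_set_subset_iff)
qed

lemma square_minimal_nbhd:
  assumes x: "x \<in> pts square" and U: "nbhd square x U"
  shows "pts square - {pr_map flip flip x} \<subseteq> U"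
proof -
  obtain a b where ab: "x = Pr a b" "a \<in> {Num 0, Num 1}" "b \<in> {Num 0, Num 1}"
    using x unfolding pts_square by (rule pr_setE)
  have top: "V = {Num 0, Num 1}" if "nbhd (spc J_top) u V" for u :: "'a pt" and V
    using that by (auto simp: nbhd_def J_top_def split: if_splits)
  have "pr_set {a} {Num 0, Num 1} \<union> pr_set {Num 0, Num 1} {b} \<subseteq> U"
    using U unfolding ab(1) square_def nbhd_box_op by (metis top)
  then show ?thesis
    using ab by (auto simp: pts_square pr_map_def flip_def pr_set_subset_iff elim!: pr_setE)
qed

lemma flip_square:
  assumes "x \<in> pts square"
  shows "pr_map flip flip x \<in> pts square" "pr_map flip flip (pr_map flip flip x) = x"
  using assms by (auto simp: pts_square pr_map_def flip_def elim!: pr_setE)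

lemma finite_square: "finite (pts square)"
proof -
  have "pts square \<subseteq> (\<lambda>(a, b). Pr a b) ` ({Num 0, Num 1} \<times> {Num 0, Num 1})"
    by (auto simp: pts_square pr_set_def)
  then show ?thesis by (rule finite_subset) simp
qed

text \<open>Write N(x) for the least neighbourhood of \<open>x\<close>. Joint continuity puts the
  image of N(x) at time s near t into N(H(x,t)). Being the identity must be shown to pass both from
  t to s and from s to t, since local constancy is an equivalence.\<close>

lemma square_id_rigid:
  fixes H :: "'a pt \<Rightarrow> 'a pt"
  assumes H: "cl_continuous (times_op square (spc I_tau)) square H"
  shows "(\<forall>x\<in>pts square. H (Pr x (Num 0)) = x) = (\<forall>x\<in>pts square. H (Pr x (Num 1)) = x)"
proof (rule locally_constant_Icc)
  fix t :: real assume t: "t \<in> {0..1}"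
  let ?o = "pr_map flip flip"
  have Hp: "H (Pr x (Num s)) \<in> pts square" if "x \<in> pts square" "s \<in> {0..1}" for x s
    using cl_continuous_pts[OF H] that by simp
  \<comment> \<open>The inclusion into N(H(x,t)) is spelled out as avoiding the opposite vertex.
    Finiteness of the square gives one range of times for all \<open>x\<close>.\<close>
  have "\<forall>\<^sub>F s in nhds t. \<forall>x\<in>pts square. s \<in> {0..1} \<longrightarrow>
      (\<forall>y\<in>pts square. y \<noteq> ?o x \<longrightarrow> H (Pr y (Num s)) \<noteq> ?o (H (Pr x (Num t))))"
  proof (intro eventually_ball_finite finite_square ballI)
    fix x :: "'a pt" assume x: "x \<in> pts square"
    obtain W where W: "nbhd (times_op square (spc I_tau)) (Pr x (Num t)) W"
      "H ` W \<subseteq> pts square - {?o (H (Pr x (Num t)))}"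
      using cl_continuous_nbhd[OF closure_space_times_op[OF closure_space_square closure_space_I_tau]
          closure_space_square H _ nbhd_square[OF Hp[OF x t]]] x t by auto
    obtain U V where U: "nbhd square x U" and V: "nbhd (spc I_tau) (Num t) V" and UV: "pr_set U V \<subseteq> W"
      using W(1) unfolding nbhd_times_op by blast
    have "y \<in> U" if "y \<in> pts square" "y \<noteq> ?o x" for y
      using square_minimal_nbhd[OF x U] that by blast
    moreover have "\<forall>\<^sub>F s in nhds t. s \<in> {0..1} \<longrightarrow> Num s \<in> V" using V nbhd_I_tau[OF t] by blast
    ultimately show "\<forall>\<^sub>F s in nhds t. s \<in> {0..1} \<longrightarrow>
        (\<forall>y\<in>pts square. y \<noteq> ?o x \<longrightarrow> H (Pr y (Num s)) \<noteq> ?o (H (Pr x (Num t))))"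
      by (elim eventually_mono) (use UV W(2) in \<open>fastforce simp: pr_set_subset_iff\<close>)
  qed
  then show "\<forall>\<^sub>F s in nhds t. s \<in> {0..1} \<longrightarrow>
      (\<forall>x\<in>pts square. H (Pr x (Num s)) = x) = (\<forall>x\<in>pts square. H (Pr x (Num t)) = x)"
  proof (rule eventually_mono, intro impI iffI ballI)
    fix s and x :: "'a pt"
    assume st: "\<forall>x\<in>pts square. s \<in> {0..1} \<longrightarrow>
        (\<forall>y\<in>pts square. y \<noteq> ?o x \<longrightarrow> H (Pr y (Num s)) \<noteq> ?o (H (Pr x (Num t))))"
      and s: "s \<in> {0..1}" and x: "x \<in> pts square"
    {
      assume id: "\<forall>x\<in>pts square. H (Pr x (Num s)) = x"
      \<comment> \<open>With the identity at time s, N(x) lies in N(H(x,t)). So \<open>?y\<close>,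
        which the latter omits, is omitted by N(x) as well and must be the vertex opposite
        \<open>x\<close>.\<close>
      let ?y = "?o (H (Pr x (Num t)))"
      have "?y \<in> pts square" using flip_square(1) Hp x t by blast
      then have "?y = ?o x" using st s x id by metis
      then show "H (Pr x (Num t)) = x" using flip_square(2) Hp x t by metis
    next
      assume id: "\<forall>x\<in>pts square. H (Pr x (Num t)) = x"
      let ?z = "H (Pr x (Num s))"
      have z: "?z \<in> pts square" using Hp x s by blast
      \<comment> \<open>Use \<open>st\<close> at the vertex opposite \<open>?z\<close>, which is
        fixed at time t: if \<open>x\<close> were not \<open>?z\<close>, then H(x,s) would have to
        avoid \<open>?z\<close>, its own value.\<close>
      show "?z = x" using st s x id flip_square[OF z] by metis
    }
  qed
qed

lemma J_top_box_not_le_I_tau_times: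
  "\<not> le_uniform (J_top, box_op) (I_tau, times_op :: 'a prod_op)"
proof
  define Q :: "'a space" where "Q = square"
  have Q: "closure_space Q" by (simp add: Q_def closure_space_square)
  let ?\<sigma> = "pr_map flip (\<lambda>x. x)"
  define f g where "f = restrict (\<lambda>x. x) (pts Q)" and "g = restrict ?\<sigma> (pts Q)"
  \<comment> \<open>This fails to be jointly continuous: a vertical neighbour of \<open>x\<close>,
    once reflected, is the vertex opposite \<open>x\<close>.\<close>
  define H where "H p = (if pr2 p = Num 0 then pr1 p else ?\<sigma> (pr1 p))" for p :: "'a pt"
  have flip: "cl_continuous (spc J_top) (spc J_top) flip"
    by (intro cl_continuous_into_J_top closure_space_J_top) (auto simp: flip_def)
  have \<sigma>: "cl_continuous Q Q ?\<sigma>"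
    unfolding Q_def square_def
    by (intro product_operationD(2) product_operation_box_op closure_space_J_top flip cl_continuous_id)
  have f_cont: "cl_continuous Q Q f" and g_cont: "cl_continuous Q Q g"
    using cl_continuous_id[of Q] \<sigma> cl_continuous_cong[OF Q, of f "\<lambda>x. x" Q]
      cl_continuous_cong[OF Q, of g ?\<sigma> Q] by (auto simp: f_def g_def)
  then have fg: "f \<in> cl_maps Q Q" "g \<in> cl_maps Q Q" by (auto simp: cl_maps_def f_def g_def)
  have "cl_continuous (box_op Q (spc J_top)) Q H"
  proof (rule cl_continuous_on_box_op[OF Q closure_space_J_top Q])
    fix x assume "x \<in> pts Q"
    then obtain a b where x: "x = Pr a b" "a \<in> {Num 0, Num 1}" "b \<in> {Num 0, Num 1}"
      unfolding Q_def pts_square by (rule pr_setE)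
    \<comment> \<open>With \<open>x\<close> fixed only the first coordinate moves, and it does so
      inside \<open>J_top\<close>, where every function is continuous.\<close>
    have 1: "cl_continuous (spc J_top) (spc J_top) (\<lambda>t. if t = Num 0 then a else flip a)"
      using x(2) by (intro cl_continuous_into_J_top closure_space_J_top) (auto simp: flip_def)
    have 2: "cl_continuous (spc J_top) Q (\<lambda>a. Pr a b)"
      unfolding Q_def square_def using x(3)
      by (intro cl_continuous_section2_box_op closure_space_J_top) simp
    have "H (Pr x t) = Pr (if t = Num 0 then a else flip a) b" for t
      by (simp add: H_def x(1) pr_map_def)
    then show "cl_continuous (spc J_top) Q (\<lambda>t. H (Pr x t))"
      using cl_continuous_compose[OF 1 2] by simp
  next
    fix t show "cl_continuous Q Q (\<lambda>x. H (Pr x t))"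
      using \<sigma> cl_continuous_id[of Q] by (cases "t = Num 0") (simp_all add: H_def)
  qed
  then have h: "elem_homotopic (J_top, box_op) Q Q f g"
    using fg by (auto simp: elem_homotopic_def J_top_def H_def f_def g_def intro!: exI)
  have "homotopic_by (J_top, box_op) Q Q f g"
    unfolding homotopic_by_def by (rule r_into_equivclp) (rule h)
  moreover assume "le_uniform (J_top, box_op) (I_tau, times_op :: 'a prod_op)"
  ultimately have fg': "homotopic_by (I_tau, times_op) Q Q f g"
    using Q fg unfolding le_uniform_def le_at_def by blast
  have rigid: "(u = f) = (v = f)" if uv: "elem_homotopic (I_tau, times_op) Q Q u v" for u v
  proof -
    obtain K where K: "cl_continuous (times_op Q (spc I_tau)) Q K"
      "\<forall>x\<in>pts Q. K (Pr x (Num 0)) = u x \<and> K (Pr x (Num 1)) = v x"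
      using uv by (auto simp: elem_homotopic_def I_tau_def)
    \<comment> \<open>Extensionality turns equality with \<open>f\<close> into the pointwise
      condition that \<open>square_id_rigid\<close> transports between the two ends.\<close>
    have "w = f \<longleftrightarrow> (\<forall>x\<in>pts Q. w x = x)" if "w \<in> extensional (pts Q)" for w
      using that extensionalityI[of w "pts Q" f] by (auto simp: f_def)
    moreover have "u \<in> extensional (pts Q)" "v \<in> extensional (pts Q)"
      using uv by (auto simp: elem_homotopic_def cl_maps_def)
    ultimately show ?thesis
      using square_id_rigid[OF K(1)[unfolded Q_def]] K(2) by (simp add: Q_def)
  qed
  from homotopic_by_eqI[OF rigid fg'] have "g = f" by simp
  moreover have "Pr (Num 0) (Num 0) \<in> pts Q" by (simp add: Q_def pts_square)
  then have "f (Pr (Num 0) (Num 0)) = Pr (Num 0) (Num 0)"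
    and "g (Pr (Num 0) (Num 0)) = ?\<sigma> (Pr (Num 0) (Num 0))"
    unfolding f_def g_def by simp_all
  ultimately show False by (simp add: pr_map_def flip_def)
qed

lemma eight_pairs_hasse_diagram:
  "card (eight_pairs :: 'a htpy_pair set) = 8 \<and>
   partial_order_on eight_pairs (pairs_order :: ('a htpy_pair \<times> 'a htpy_pair) set) \<and>
   hasse_edges (pairs_order :: ('a htpy_pair \<times> 'a htpy_pair) set) = diagram_edges"
proof -
  have refl: "le_uniform p p" for p :: "'a htpy_pair"
    by (simp add: le_uniform_def le_at_def)
  have trans: "le_uniform p r" if "le_uniform p q" "le_uniform q r" for p q r :: "'a htpy_pair"
    using that by (simp add: le_uniform_def le_at_def)
  have edge: "le_uniform p q" if "(p, q) \<in> diagram_edges" for p q :: "'a htpy_pair"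
    unfolding le_uniform_def by (intro allI impI le_at_diagram_edges that)
  have edges:
    "le_uniform (J_pt, times_op) (J_top, times_op :: 'a prod_op)"
    "le_uniform (J_top, times_op) (J_plus, times_op :: 'a prod_op)"
    "le_uniform (J_top, times_op) (J_top, box_op :: 'a prod_op)"
    "le_uniform (J_plus, times_op) (I_tau, times_op :: 'a prod_op)"
    "le_uniform (J_plus, times_op) (J_plus, box_op :: 'a prod_op)"
    "le_uniform (J_top, box_op) (J_plus, box_op :: 'a prod_op)"
    "le_uniform (I_tau, times_op) (I_tau, box_op :: 'a prod_op)"
    "le_uniform (J_plus, box_op) (I_tau, box_op :: 'a prod_op)"
    "le_uniform (I_tau, box_op) (J_bot, times_op :: 'a prod_op)"
    by (rule edge, simp add: diagram_edges_def)+
  show ?thesis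
    unfolding pairs_order_def eight_pairs_def diagram_edges_def
    by (rule eight_element_hasse_diagram)
      (fact refl edges J_top_times_not_le_J_pt_times J_plus_times_not_le_J_top_box
        J_top_box_not_le_I_tau_times I_tau_times_not_le_J_plus_box J_bot_times_not_le_I_tau_box |
       erule trans, assumption)+
qed

theorem theorem4p37:
  fixes X Y :: "'a space"
  assumes "closure_space X" and "closure_space Y"
  shows "(\<forall>p\<in>(eight_pairs :: 'a htpy_pair set). interval_pair p)
    \<and> card (eight_pairs :: 'a htpy_pair set) = 8
    \<and> (\<forall>(p, q)\<in>diagram_edges. le_at X Y p q)
    \<and> partial_order_on eight_pairs (pairs_order :: ('a htpy_pair \<times> 'a htpy_pair) set)
    \<and> hasse_edges (pairs_order :: ('a htpy_pair \<times> 'a htpy_pair) set) = diagram_edges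
    \<and> (\<forall>f\<in>cl_maps X Y. \<forall>g\<in>cl_maps X Y. homotopic_by (J_pt, times_op) X Y f g \<longleftrightarrow> f = g)
    \<and> (\<forall>p. interval_pair p \<longrightarrow> le_at X Y (J_pt, times_op) p)
    \<and> (\<forall>f\<in>cl_maps X Y. \<forall>g\<in>cl_maps X Y. homotopic_by (J_bot, times_op) X Y f g)
    \<and> (\<forall>p. interval_pair p \<longrightarrow> le_at X Y p (J_bot, times_op))"
proof (intro conjI)
  show "\<forall>p\<in>(eight_pairs :: 'a htpy_pair set). interval_pair p"
    by (simp add: interval_pair_eight_pairs)
  show "\<forall>(p, q)\<in>diagram_edges. le_at X Y p q"
    using le_at_diagram_edges[OF assms] by blast
  show "\<forall>f\<in>cl_maps X Y. \<forall>g\<in>cl_maps X Y. homotopic_by (J_pt, times_op) X Y f g \<longleftrightarrow> f = g"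
    by (simp add: homotopic_by_J_pt_iff)
  show "\<forall>p. interval_pair p \<longrightarrow> le_at X Y (J_pt, times_op) p"
    by (simp add: J_pt_le_at)
  show bot: "\<forall>f\<in>cl_maps X Y. \<forall>g\<in>cl_maps X Y. homotopic_by (J_bot, times_op) X Y f g"
    using elem_homotopic_J_bot[OF assms] unfolding homotopic_by_def by blast
  show "\<forall>p. interval_pair p \<longrightarrow> le_at X Y p (J_bot, times_op)"
    using bot by (simp add: le_at_def)
qed (use eight_pairs_hasse_diagram in blast)+

end
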